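(* Let $D$ be a knot diagram in the annulus, and let $D^*$ and $ec(D^* )$ be obtained from $D$ by the region-coloring procedure (Method 1) described in the context. Then $$w_{ST}(D)=ec(D^* ).$$
   Context: The annulus is regarded as the plane with a marked point, the center. A meridian for $D$ is an arc (not necessarily a line segment) running from the center of the annulus to the exterior (unbounded region) of $D$, crossing $D$ transversally away from its crossings. The wrapping number $w_{ST}(D)$ of the diagram $D$ is the minimal number of intersection points of such a meridian with $D$. Method 1. (0) Start at the region containing the center of the annulus. (1) Color the current region, using a new color, until its bounds are met. (2) Split (smooth) every crossing lying on the boundary of the colored region in the way that keeps the colored region separated from the opposite corner at that crossing (i.e. the two other corners of the crossing, which are adjacent to the colored corner, are merged). The colored region then becomes bounded on the outside by a circuit encircling the center. (3) Advance to the contiguous region on the outer side of this circuit; uncolored inner isolated regions that may have appeared are ignored. (4) If that region is bounded, repeat from (1); if it is unbounded, stop. The resulting diagram is denoted $D^*$, and $ec(D^* )$ is the number of colors used. (If the center lies in the unbounded region of $D$, nothing is colored and $ec(D^* )=0$.) *)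

theory Defs
  imports "HOL-Analysis.Analysis"
begin

text \<open>
  The annulus is the plane \<open>complex\<close> with a marked point \<open>c\<close>, its center. Diagrams are taken in the
  locally flat topological category, which covers smooth and piecewise linear diagrams alike:
  the required local pictures are imposed through coordinate discs.
\<close>

definition chart :: "complex \<Rightarrow> complex set \<Rightarrow> (complex \<Rightarrow> complex) \<Rightarrow> bool" where
  "chart p U f \<longleftrightarrow> open U \<and> p \<in> U \<and> f p = 0 \<and> (\<exists>g. homeomorphism U (ball 0 1) f g)"

definition looks_like :: "complex set \<Rightarrow> complex set \<Rightarrow> (complex \<Rightarrow> complex) \<Rightarrow> complex set \<Rightarrow> bool" where
  "looks_like D U f M \<longleftrightarrow> f ` (D \<inter> U) = M \<inter> ball 0 1"

definition real_axis :: "complex set" where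
  "real_axis = {z. Im z = 0}"

definition imag_axis :: "complex set" where
  "imag_axis = {z. Re z = 0}"

definition crossings :: "complex set \<Rightarrow> complex set" where
  "crossings D = {p. \<exists>U f. chart p U f \<and> looks_like D U f (real_axis \<union> imag_axis)}"

text \<open>
  A knot diagram is a closed curve \<open>\<gamma>\<close>, a map on the unit circle, which is locally flat and
  injective apart from finitely many transverse double points, together with the choice
  \<open>over x\<close> of the parameter of the overpassing strand at each crossing \<open>x\<close>.
  Regions, meridians and splittings depend only on the image of \<open>\<gamma>\<close>.
\<close>

definition shadow :: "(complex \<Rightarrow> complex) \<Rightarrow> complex set" where
  "shadow \<gamma> = \<gamma> ` sphere 0 1"

definition regular_point :: "(complex \<Rightarrow> complex) \<Rightarrow> complex \<Rightarrow> bool" where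
  "regular_point \<gamma> p \<longleftrightarrow>
     (\<exists>!s. s \<in> sphere 0 1 \<and> \<gamma> s = p) \<and>
     (\<exists>U f. chart p U f \<and> looks_like (shadow \<gamma>) U f real_axis)"

definition transverse_double_point :: "(complex \<Rightarrow> complex) \<Rightarrow> complex \<Rightarrow> bool" where
  "transverse_double_point \<gamma> p \<longleftrightarrow>
     (\<exists>s t U f. s \<noteq> t \<and> {u \<in> sphere 0 1. \<gamma> u = p} = {s, t} \<and>
        chart p U f \<and> looks_like (shadow \<gamma>) U f (real_axis \<union> imag_axis) \<and>
        (\<exists>V. open V \<and> s \<in> V \<and> (\<forall>u \<in> V \<inter> sphere 0 1. \<gamma> u \<in> U \<and> f (\<gamma> u) \<in> real_axis)) \<and>
        (\<exists>W. open W \<and> t \<in> W \<and> (\<forall>u \<in> W \<inter> sphere 0 1. \<gamma> u \<in> U \<and> f (\<gamma> u) \<in> imag_axis)))"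

definition knot_diagram :: "complex \<Rightarrow> (complex \<Rightarrow> complex) \<Rightarrow> (complex \<Rightarrow> complex) \<Rightarrow> bool" where
  "knot_diagram c \<gamma> over \<longleftrightarrow>
     continuous_on (sphere 0 1) \<gamma> \<and> c \<notin> shadow \<gamma> \<and>
     finite (crossings (shadow \<gamma>)) \<and>
     (\<forall>p \<in> shadow \<gamma>. regular_point \<gamma> p \<or> transverse_double_point \<gamma> p) \<and>
     (\<forall>x \<in> crossings (shadow \<gamma>). over x \<in> sphere 0 1 \<and> \<gamma> (over x) = x)"

text \<open>
  For compact \<open>D\<close>, \<open>outside D\<close> is the unbounded region. Transversality makes the intersection
  finite; this is recorded explicitly because \<open>card\<close> vanishes on infinite sets.
\<close>

definition meridian :: "complex \<Rightarrow> complex set \<Rightarrow> (real \<Rightarrow> complex) \<Rightarrow> bool" where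
  "meridian c D m \<longleftrightarrow>
     arc m \<and> pathstart m = c \<and> pathfinish m \<in> outside D \<and>
     path_image m \<inter> crossings D = {} \<and>
     finite (path_image m \<inter> D) \<and>
     (\<forall>p \<in> path_image m \<inter> D. \<exists>U f. chart p U f \<and>
        looks_like D U f real_axis \<and> looks_like (path_image m) U f imag_axis)"

definition wrapping_number :: "complex \<Rightarrow> complex set \<Rightarrow> nat" where
  "wrapping_number c D = (LEAST n. \<exists>m. meridian c D m \<and> card (path_image m \<inter> D) = n)"

text \<open>
  Splitting a crossing: inside the diamond the cross is replaced by the two sides of the diamond
  lying in the first and third quadrants. This cuts these two opposite corners off from each
  other and merges the second quadrant with the fourth.
\<close>

definition diamond :: "complex set" where
  "diamond = {z. \<bar>Re z\<bar> + \<bar>Im z\<bar> \<le> 1/2}"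

definition split_cross :: "complex set" where
  "split_cross = ((real_axis \<union> imag_axis) - diamond) \<union>
     {z. \<bar>Re z\<bar> + \<bar>Im z\<bar> = 1/2 \<and> 0 \<le> Re z * Im z}"

text \<open>
  All crossings of \<open>D\<close> on the boundary of the region \<open>R\<close> are split, in disjoint coordinate discs
  of the annulus whose first quadrant is a corner of \<open>R\<close>. The resulting diagram is \<open>D'\<close>, and \<open>R'\<close>
  is what remains of the colored region.
\<close>

definition split_boundary ::
  "complex \<Rightarrow> complex set \<Rightarrow> complex set \<Rightarrow> complex set \<Rightarrow> complex set \<Rightarrow> bool" where
  "split_boundary c D R D' R' \<longleftrightarrow>
     (let X = crossings D \<inter> frontier R in
      \<exists>U f. (\<forall>x \<in> X. chart x (U x) (f x) \<and> c \<notin> U x \<and>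
                looks_like D (U x) (f x) (real_axis \<union> imag_axis) \<and>
                {z \<in> U x. 0 < Re (f x z) \<and> 0 < Im (f x z)} \<subseteq> R) \<and>
            disjoint_family_on U X \<and>
            D' = (D - (\<Union>x\<in>X. U x)) \<union> (\<Union>x\<in>X. {z \<in> U x. f x z \<in> split_cross}) \<and>
            R' = R - (\<Union>x\<in>X. {z \<in> U x. f x z \<in> diamond}))"

definition outer_circuit :: "complex \<Rightarrow> complex set \<Rightarrow> complex set \<Rightarrow> bool" where
  "outer_circuit c R C \<longleftrightarrow>
     (\<exists>h. simple_path h \<and> pathfinish h = pathstart h \<and> path_image h = C) \<and>
     C \<subseteq> frontier R \<and> R \<subseteq> inside C \<and> c \<in> inside C"

definition next_region :: "complex \<Rightarrow> complex set \<Rightarrow> complex set \<Rightarrow> complex set \<Rightarrow> bool" where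
  "next_region c D R S \<longleftrightarrow>
     (\<exists>C. outer_circuit c R C \<and> S \<in> components (- D) \<and> S \<subseteq> outside C \<and> C \<subseteq> frontier S)"

text \<open>
  \<open>color_from c D R E Rs\<close>: starting the procedure at the region \<open>R\<close> of the current diagram \<open>D\<close>,
  it may end with the diagram \<open>E\<close>, having colored, in this order, the regions \<open>Rs\<close>,
  each with a color of its own. Disregarding the choice of the splitting discs, the steps are
  deterministic.
\<close>

inductive color_from ::
  "complex \<Rightarrow> complex set \<Rightarrow> complex set \<Rightarrow> complex set \<Rightarrow> complex set list \<Rightarrow> bool"
  for c :: complex where
  stop: "\<not> bounded R \<Longrightarrow> color_from c D R D []"
| color: "bounded R \<Longrightarrow> split_boundary c D R D' R' \<Longrightarrow> next_region c D' R' S \<Longrightarrow>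
    color_from c D' S E Rs \<Longrightarrow> color_from c D R E (R' # Rs)"

type_synonym colored_diagram = "complex set \<times> complex set list"

definition method1 :: "complex \<Rightarrow> complex set \<Rightarrow> colored_diagram \<Rightarrow> bool" where
  "method1 c D Dstar \<longleftrightarrow>
     color_from c D (connected_component_set (- D) c) (fst Dstar) (snd Dstar)"

definition ec :: "colored_diagram \<Rightarrow> nat" where
  "ec Dstar = length (snd Dstar)"

end

theory Submission imports Defs begin

text \<open>
  Let \<open>n\<close> be the number of colors. Both inequalities are proved by following the procedure backwards,
  one round at a time; a round passes from the diagram \<open>D\<close> with current region \<open>R\<close> to the split diagram
  \<open>D'\<close> with next region \<open>S\<close>. The induction runs over compact sets that look locally
  like a line or a cross, with finitely many crossings (\<open>tame\<close>): splitting preserves this, although it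
  may break the curve into several.

  \<^emph>\<open>At least \<open>n\<close> crossings.\<close> Call a function on the faces of a diagram a potential if it changes by at most
  one across every edge. A meridian meets the diagram at least as often as a potential grows along it
  (\<open>meridian_ge_potential\<close>), so a potential is wanted that is \<open>0\<close> at the center and \<open>n\<close> far away. Given
  such a potential for \<open>D'\<close> and \<open>S\<close> with \<open>n - 1\<close> in place of \<open>n\<close>, raise it by one outside the circuit that bounds
  the colored region and set it to \<open>0\<close> inside (\<open>face_potential_beyond_circuit\<close>). Since \<open>D\<close> and \<open>D'\<close> agree outside
  the diamonds, and every quadrant of \<open>D\<close> at a split crossing reaches beyond the diamond, the result
  can be read as a potential for \<open>D\<close> (\<open>face_potential_pull_back\<close>).

  \<^emph>\<open>At most \<open>n\<close> crossings.\<close> Here one follows chains of adjacent faces, and a chain of \<open>n - 1\<close> steps in \<open>D'\<close> from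
  \<open>S\<close> to the exterior must be turned into a chain of \<open>n\<close> steps in \<open>D\<close> from \<open>R\<close>. The difficulty is that a
  face of \<open>D'\<close> may consist of several faces of \<open>D\<close>, merged at split crossings. But each of them then
  has a corner next to one of \<open>R\<close> and can be reached from \<open>R\<close> in one step, so that the chain may be
  restarted there (\<open>level_step\<close>). The chain of faces is finally realized by a path that crosses edges at distinct points,
  and an arc contained in that path is a meridian (\<open>crossing_path_of_level\<close>, \<open>meridian_of_crossing_path\<close>).
\<close>

section \<open>Coordinate discs\<close>

lemma looks_like_iff:
  assumes "chart p U f"
  shows "looks_like D U f M \<longleftrightarrow> (\<forall>z\<in>U. z \<in> D \<longleftrightarrow> f z \<in> M)"
proof -
  obtain g where g: "homeomorphism U (ball 0 1) f g"
    using assms by (auto simp: chart_def)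
  then have im: "f ` U = ball 0 1" and inv: "\<And>z. z \<in> U \<Longrightarrow> g (f z) = z"
    and inv': "\<And>z. z \<in> ball 0 1 \<Longrightarrow> f (g z) = z" "\<And>z. z \<in> ball 0 1 \<Longrightarrow> g z \<in> U"
    by (auto simp: homeomorphism_def)
  show ?thesis
  proof
    assume L: "looks_like D U f M"
    show "\<forall>z\<in>U. z \<in> D \<longleftrightarrow> f z \<in> M"
    proof
      fix z assume z: "z \<in> U"
      show "z \<in> D \<longleftrightarrow> f z \<in> M"
      proof
        assume "z \<in> D" then show "f z \<in> M" using L z by (auto simp: looks_like_def)
      next
        assume "f z \<in> M"
        then have "f z \<in> f ` (D \<inter> U)" using L z im by (auto simp: looks_like_def)
        then show "z \<in> D" using inv z by (metis IntE imageE)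
      qed
    qed
  next
    assume R: "\<forall>z\<in>U. z \<in> D \<longleftrightarrow> f z \<in> M"
    have "f ` (D \<inter> U) \<subseteq> M \<inter> ball 0 1" using R im by auto
    moreover have "M \<inter> ball 0 1 \<subseteq> f ` (D \<inter> U)"
    proof
      fix w assume "w \<in> M \<inter> ball 0 1"
      then have "f (g w) = w" "g w \<in> U" "w \<in> M" using inv' by auto
      with R show "w \<in> f ` (D \<inter> U)" by (metis IntI imageI)
    qed
    ultimately show "looks_like D U f M" unfolding looks_like_def by (rule subset_antisym)
  qed
qed

lemma chart_of_homeomorphism:
  assumes h: "homeomorphism V W F G" and "open V" "p \<in> V" "F p = 0" and e: "0 < e" "ball 0 e \<subseteq> W"
  shows "chart p {z \<in> V. norm (F z) < e} (\<lambda>z. F z / of_real e)"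
proof -
  let ?U = "{z \<in> V. norm (F z) < e}"
  have cF: "continuous_on V F" and cG: "continuous_on W G" and FV: "F ` V = W"
    and GF: "\<And>z. z \<in> V \<Longrightarrow> G (F z) = z" and FG: "\<And>w. w \<in> W \<Longrightarrow> F (G w) = w"
    and GW: "\<And>w. w \<in> W \<Longrightarrow> G w \<in> V"
    using h by (auto simp: homeomorphism_def)
  have "?U = V \<inter> F -` ball 0 e" by auto
  then have op: "open ?U"
    using cF \<open>open V\<close> continuous_open_preimage by (metis open_ball)
  have inW: "of_real e * w \<in> ball 0 e" "of_real e * w \<in> W" if "norm w < 1" for w :: complex
  proof -
    show "of_real e * w \<in> ball 0 e" using that e(1) by (simp add: norm_mult)
    then show "of_real e * w \<in> W" using e by blast
  qed
  have "homeomorphism ?U (ball 0 1) (\<lambda>z. F z / of_real e) (\<lambda>w. G (of_real e * w))"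
  proof (rule homeomorphismI)
    show "continuous_on ?U (\<lambda>z. F z / of_real e)"
      using e by (intro continuous_intros continuous_on_subset[OF cF]) auto
    show "continuous_on (ball 0 1) (\<lambda>w. G (of_real e * w))"
      by (rule continuous_on_compose2[OF cG]) (auto intro!: continuous_intros inW)
    show "(\<lambda>z. F z / of_real e) ` ?U \<subseteq> ball 0 1"
      using e by (auto simp: norm_divide)
    show "(\<lambda>w. G (of_real e * w)) ` ball 0 1 \<subseteq> ?U"
      using inW FG GW by (auto simp: norm_mult)
    show "G (of_real e * (F z / of_real e)) = z" if "z \<in> ?U" for z
      using that GF e by auto
    show "F (G (of_real e * w)) / of_real e = w" if "w \<in> ball 0 1" for w
      using that FG[OF inW(2)] e by auto
  qed
  then show ?thesis using op assms by (auto simp: chart_def)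
qed

text \<open>
  The model pictures are invariant under positive scaling. A coordinate disc may therefore be shrunk
  into any neighbourhood of its center without changing the picture, which makes the property of
  being a crossing or a regular point local.
\<close>

definition cone :: "complex set \<Rightarrow> bool" where
  "cone M \<longleftrightarrow> (\<forall>z e. 0 < e \<longrightarrow> z / of_real e \<in> M \<longleftrightarrow> z \<in> M)"

lemma cone_axes: "cone real_axis" "cone imag_axis" "cone (real_axis \<union> imag_axis)"
  by (auto simp: cone_def real_axis_def imag_axis_def)

lemma chart_shrink:
  assumes ch: "chart p U f" and N: "open N" "p \<in> N"
  obtains r where "0 < r" "{z \<in> U. norm (f z) < r} \<subseteq> N"
    "chart p {z \<in> U. norm (f z) < r} (\<lambda>z. f z / of_real r)"
proof -
  obtain g where g: "homeomorphism U (ball 0 1) f g" and U: "open U" "p \<in> U" "f p = 0"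
    using ch by (auto simp: chart_def)
  have "open (ball 0 1 \<inter> g -` N)"
    using g N by (auto simp: homeomorphism_def intro: continuous_open_preimage)
  moreover have "0 \<in> ball 0 1 \<inter> g -` N"
    using g U N by (auto simp: homeomorphism_def)
  ultimately obtain r where r: "0 < r" "ball 0 r \<subseteq> ball 0 1 \<inter> g -` N"
    by (meson openE)
  show thesis
  proof
    show "{z \<in> U. norm (f z) < r} \<subseteq> N"
    proof clarsimp
      fix z assume "z \<in> U" "cmod (f z) < r"
      then have "g (f z) \<in> N" using r by (auto simp: subset_iff)
      then show "z \<in> N" using g \<open>z \<in> U\<close> by (auto simp: homeomorphism_def)
    qed
    have "ball (0::complex) r \<subseteq> ball 0 1" using r by blast
    then show "chart p {z \<in> U. norm (f z) < r} (\<lambda>z. f z / of_real r)"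
      using chart_of_homeomorphism[OF g U r(1)] by blast
  qed (rule r(1))
qed

definition regular :: "complex set \<Rightarrow> complex \<Rightarrow> bool" where
  "regular D p \<longleftrightarrow> (\<exists>U f. chart p U f \<and> looks_like D U f real_axis)"

lemma chart_local:
  assumes ch: "chart p U f" and L: "looks_like D U f M" and M: "cone M"
    and N: "open N" "p \<in> N" "\<And>z. z \<in> N \<Longrightarrow> z \<in> D \<longleftrightarrow> z \<in> D'"
  shows "\<exists>U f. chart p U f \<and> looks_like D' U f M \<and> U \<subseteq> N"
proof -
  obtain r where r: "0 < r" "{z \<in> U. norm (f z) < r} \<subseteq> N"
    and c: "chart p {z \<in> U. norm (f z) < r} (\<lambda>z. f z / of_real r)"
    using chart_shrink[OF ch N(1,2)] by blast
  have "looks_like D' {z \<in> U. norm (f z) < r} (\<lambda>z. f z / of_real r) M"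
    using L M r N(3) unfolding looks_like_iff[OF c] looks_like_iff[OF ch] cone_def by blast
  then show ?thesis using c r by blast
qed

lemma regular_local:
  assumes "regular D p" "open N" "p \<in> N" "\<And>z. z \<in> N \<Longrightarrow> z \<in> D \<longleftrightarrow> z \<in> D'"
  shows "regular D' p"
proof -
  obtain U f where "chart p U f" "looks_like D U f real_axis"
    using assms(1) by (auto simp: regular_def)
  from chart_local[OF this cone_axes(1) assms(2-4)] show ?thesis
    unfolding regular_def by blast
qed

lemma crossings_local:
  assumes "p \<in> crossings D" "open N" "p \<in> N" "\<And>z. z \<in> N \<Longrightarrow> z \<in> D \<longleftrightarrow> z \<in> D'"
  shows "p \<in> crossings D'"
proof -
  obtain U f where "chart p U f" "looks_like D U f (real_axis \<union> imag_axis)"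
    using assms(1) by (auto simp: crossings_def)
  from chart_local[OF this cone_axes(3) assms(2-4)] show ?thesis
    unfolding crossings_def by blast
qed

lemma crossings_subset: "crossings D \<subseteq> D"
proof
  fix p assume "p \<in> crossings D"
  then obtain U f where ch: "chart p U f" and "looks_like D U f (real_axis \<union> imag_axis)"
    by (auto simp: crossings_def)
  then show "p \<in> D"
    unfolding looks_like_iff[OF ch] using ch by (auto simp: chart_def real_axis_def)
qed

lemma regular_of_homeomorphism:
  assumes h: "homeomorphism V W F G" and V: "open V" "open W" "p \<in> V" and p: "F p = 0"
    and D: "\<And>z. z \<in> V \<Longrightarrow> z \<in> D \<longleftrightarrow> F z \<in> real_axis"
  shows "regular D p"
proof -
  have "0 \<in> W" using h V p by (auto simp: homeomorphism_def)
  then obtain e where e: "0 < e" "ball 0 e \<subseteq> W" using \<open>open W\<close> by (meson openE)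
  note c = chart_of_homeomorphism[OF h V(1,3) p e]
  have "looks_like D {z \<in> V. norm (F z) < e} (\<lambda>z. F z / of_real e) real_axis"
    unfolding looks_like_iff[OF c] using D cone_axes(1) e unfolding cone_def by blast
  then show ?thesis using c by (auto simp: regular_def)
qed

text \<open>
  A line is not locally a cross: a point has only two sides on a line, so of three arms of the cross
  two would leave it on the same side. Being connected, these arms would overlap.
\<close>

lemma regular_not_crossing:
  assumes "regular D p" shows "p \<notin> crossings D"
proof
  assume "p \<in> crossings D"
  obtain U f where ch: "chart p U f" and L: "looks_like D U f real_axis"
    using assms by (auto simp: regular_def)
  obtain V0 k0 where ch0: "chart p V0 k0" and L0: "looks_like D V0 k0 (real_axis \<union> imag_axis)"
    using \<open>p \<in> crossings D\<close> by (auto simp: crossings_def)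
  obtain V k where chV: "chart p V k" and LV: "looks_like D V k (real_axis \<union> imag_axis)" and VU: "V \<subseteq> U"
    using chart_local[OF ch0 L0 cone_axes(3), of U D] ch by (auto simp: chart_def)
  obtain g where g: "homeomorphism U (ball 0 1) f g" and p: "f p = 0" using ch by (auto simp: chart_def)
  obtain h where h: "homeomorphism V (ball 0 1) k h" and kp: "k p = 0" "p \<in> V" using chV by (auto simp: chart_def)
  have h0: "h 0 = p" using h kp by (auto simp: homeomorphism_def)
  \<comment> \<open>The arm of the cross in direction \<open>u\<close>, read off as a real position on the line.\<close>
  define arm where "arm u = (\<lambda>t. Re (f (h (of_real t * u))))" for u :: complex
  have hV: "h w \<in> V" "k (h w) = w" if "norm w < 1" for w
    using h that by (auto simp: homeomorphism_def)
  have on_axis: "Im (f (h (of_real t * u))) = 0" if "u \<in> {1,-1,\<i>}" "0 \<le> t" "t < 1" for u t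
  proof -
    have n: "norm (of_real t * u) < 1" using that by (auto simp: norm_mult)
    then have "h (of_real t * u) \<in> D"
      using LV hV[OF n] that unfolding looks_like_iff[OF chV]
      by (auto simp: real_axis_def imag_axis_def)
    then show ?thesis
      using L hV[OF n] VU unfolding looks_like_iff[OF ch] by (auto simp: real_axis_def)
  qed
  have cont: "continuous_on {0..<1} (arm u)" if "u \<in> {1,-1,\<i>}" for u
  proof -
    have "continuous_on {0..<1} (\<lambda>t. h (of_real t * u))"
      by (rule continuous_on_compose2[of "ball 0 1" h])
         (use h that in \<open>auto simp: homeomorphism_def norm_mult intro!: continuous_intros\<close>)
    then have "continuous_on {0..<1} (\<lambda>t. f (h (of_real t * u)))"
      by (rule continuous_on_compose2[of U f, rotated])
         (use g that hV VU in \<open>auto simp: homeomorphism_def norm_mult subset_iff\<close>)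
    then show ?thesis unfolding arm_def by (intro continuous_intros)
  qed
  have inj: "u = v \<and> s = t"
    if "arm u s = arm v t" "u \<in> {1,-1,\<i>}" "v \<in> {1,-1,\<i>}" "0 < s" "s < 1" "0 < t" "t < 1" for u v s t
  proof -
    have n: "norm (of_real s * u) < 1" "norm (of_real t * v) < 1" using that by (auto simp: norm_mult)
    have "f (h (of_real s * u)) = f (h (of_real t * v))"
      using that on_axis[of u s] on_axis[of v t] by (auto simp: arm_def complex_eq_iff)
    moreover have "h (of_real s * u) \<in> U" "h (of_real t * v) \<in> U" using hV n VU by auto
    ultimately have "h (of_real s * u) = h (of_real t * v)"
      using g by (metis homeomorphism_apply1)
    then have "of_real s * u = of_real t * v" using hV n by metis
    then show ?thesis using that by (auto simp: complex_eq_iff)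
  qed
  have z: "arm u 0 = 0" for u using h0 p by (simp add: arm_def)
  have nz: "arm u t \<noteq> 0" if "u \<in> {1,-1,\<i>}" "0 < t" "t < 1" for u t
  proof
    assume "arm u t = 0"
    then have "f (h (of_real t * u)) = 0" using on_axis[of u t] that by (auto simp: arm_def complex_eq_iff)
    moreover have n: "norm (of_real t * u) < 1" using that by (auto simp: norm_mult)
    ultimately have "h (of_real t * u) = p"
      using g hV VU p kp by (metis homeomorphism_apply1 subsetD)
    then have "of_real t * u = 0" using hV(2)[OF n] kp by simp
    then show False using that by auto
  qed
  have sep: "sgn (arm u (1/2)) \<noteq> sgn (arm v (1/2))" if "u \<in> {1,-1,\<i>}" "v \<in> {1,-1,\<i>}" "u \<noteq> v" for u v
  proof
    assume eq: "sgn (arm u (1/2)) = sgn (arm v (1/2))"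
    have cu: "continuous_on {0..1/2} (\<lambda>t. \<bar>arm u t\<bar>)" if "u \<in> {1,-1,\<i>}" for u
      by (intro continuous_intros continuous_on_subset[OF cont[OF that]]) auto
    \<comment> \<open>Of two arms on the same side, the one whose midpoint is farther out passes the midpoint of the other.\<close>
    have key: False if uv: "u \<in> {1,-1,\<i>}" "v \<in> {1,-1,\<i>}" "u \<noteq> v" "\<bar>arm u (1/2)\<bar> \<le> \<bar>arm v (1/2)\<bar>"
      "sgn (arm u (1/2)) = sgn (arm v (1/2))" for u v
    proof -
      obtain t where t: "0 \<le> t" "t \<le> 1/2" "\<bar>arm v t\<bar> = \<bar>arm u (1/2)\<bar>"
        using IVT'[of "\<lambda>t. \<bar>arm v t\<bar>" 0 "\<bar>arm u (1/2)\<bar>" "1/2"] cu uv z by auto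
      have "t \<noteq> 0" using t z nz[of u "1/2"] uv by (auto simp del: insert_iff)
      then have tp: "0 < t" "t < 1" using t by auto
      have "sgn (arm v t) = sgn (arm v (1/2))"
      proof (rule ccontr)
        assume "sgn (arm v t) \<noteq> sgn (arm v (1/2))"
        moreover have "arm v t \<noteq> 0" "arm v (1/2) \<noteq> 0" using nz[of v t] nz[of v "1/2"] tp uv by auto
        ultimately have *: "arm v t < 0 \<and> 0 < arm v (1/2) \<or> 0 < arm v t \<and> arm v (1/2) < 0"
          by (auto simp: sgn_if split: if_splits)
        have c: "continuous_on {t..1/2} (arm v)"
          by (rule continuous_on_subset[OF cont]) (use uv tp in auto)
        have "\<exists>s\<ge>t. s \<le> 1/2 \<and> arm v s = 0"
          using * IVT'[of "arm v" t 0 "1/2"] IVT2'[of "arm v" "1/2" 0 t] c t by fastforce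
        then show False using nz[of v] uv tp by force
      qed
      then have "arm v t = arm u (1/2)"
        using uv t by (auto simp: sgn_if split: if_splits)
      then show False using inj[of v t u "1/2"] uv tp by auto
    qed
    then show False using that eq by (metis linear)
  qed
  have "sgn (arm u (1/2)) \<in> {-1,1}" if "u \<in> {1,-1,\<i>}" for u
    using nz[of u "1/2"] that by (auto simp: sgn_if)
  from this[of 1] this[of "-1"] this[of \<i>]
  moreover have "(1::complex) \<noteq> -1" "1 \<noteq> \<i>" "-1 \<noteq> \<i>" by (simp_all add: complex_eq_iff)
  moreover note sep[of 1 "-1"] sep[of 1 \<i>] sep[of "-1" \<i>]
  ultimately show False by (metis insert_iff singletonD)
qed

section \<open>Faces and potentials\<close>

text \<open>
  Near a regular point the diagram has two sides, the preimages of the two half discs; whether they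
  belong to one face or to two is left open.
\<close>

lemma regular_sides:
  assumes "regular D p" "open N" "p \<in> N"
  obtains V A B where "open V" "p \<in> V" "V \<subseteq> N" "V - D = A \<union> B" "connected A" "connected B"
proof -
  obtain V f where ch: "chart p V f" and L: "looks_like D V f real_axis" and VN: "V \<subseteq> N"
    using assms chart_local[OF _ _ cone_axes(1), of p _ _ D N D] unfolding regular_def by blast
  obtain g where g: "homeomorphism V (ball 0 1) f g" and V: "open V" "p \<in> V"
    using ch by (auto simp: chart_def)
  have half: "connected {z \<in> V. 0 < s * Im (f z)}" for s :: real
  proof -
    have "convex (ball 0 1 \<inter> {z. 0 < s * Im z})"
    proof (intro convex_Int convex_ball)
      have "{z. 0 < s * Im z} = {z. inner (Complex 0 s) z > 0}" by (auto simp: inner_complex_def)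
      then show "convex {z. 0 < s * Im z}" by (metis convex_halfspace_gt)
    qed
    then have "connected (g ` (ball 0 1 \<inter> {z. 0 < s * Im z}))"
      using g by (intro connected_continuous_image convex_connected)
        (auto simp: homeomorphism_def intro: continuous_on_subset)
    moreover have "g ` (ball 0 1 \<inter> {z. 0 < s * Im z}) = {z \<in> V. 0 < s * Im (f z)}"
    proof (intro equalityI subsetI)
      fix z assume "z \<in> {z \<in> V. 0 < s * Im (f z)}"
      then have "z = g (f z)" "f z \<in> ball 0 1 \<inter> {z. 0 < s * Im z}"
        using g by (auto simp: homeomorphism_def)
      then show "z \<in> g ` (ball 0 1 \<inter> {z. 0 < s * Im z})" by blast
    qed (use g in \<open>auto simp: homeomorphism_def\<close>)
    ultimately show ?thesis by simp
  qed
  have D: "z \<in> D \<longleftrightarrow> Im (f z) = 0" if "z \<in> V" for z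
    using L that unfolding looks_like_iff[OF ch] by (simp add: real_axis_def)
  have "V - D = {z \<in> V. 0 < 1 * Im (f z)} \<union> {z \<in> V. 0 < - 1 * Im (f z)}"
    by (intro set_eqI) (use D in \<open>simp, metis linorder_neqE_linordered_idom less_irrefl\<close>)
  from that[OF V VN this half half] show thesis .
qed

lemma face_absorbs:
  assumes "F \<in> components (- D)" "connected A" "A \<inter> D = {}" "F \<inter> A \<noteq> {}"
  shows "A \<subseteq> F"
  using assms components_maximal[of F "-D" A] by blast

text \<open>
  A potential is a function on the faces that changes by at most one across an edge. Edges are not
  mentioned: a condition on a neighbourhood of every point that is not a crossing says the same.
\<close>

definition face_potential :: "complex set \<Rightarrow> (complex \<Rightarrow> int) \<Rightarrow> bool" where
  "face_potential D \<phi> \<longleftrightarrow>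
     (\<forall>A. connected A \<and> A \<inter> D = {} \<longrightarrow> (\<forall>z\<in>A. \<forall>w\<in>A. \<phi> z = \<phi> w)) \<and>
     (\<forall>p. p \<notin> crossings D \<longrightarrow>
        (\<exists>N. open N \<and> p \<in> N \<and> (\<forall>z\<in>N - D. \<forall>w\<in>N - D. \<bar>\<phi> z - \<phi> w\<bar> \<le> 1)))"

lemma face_potential_const:
  assumes "face_potential D \<phi>" "connected A" "A \<inter> D = {}" "z \<in> A" "w \<in> A"
  shows "\<phi> z = \<phi> w"
  using assms unfolding face_potential_def by blast

lemma face_potential_jump:
  assumes "face_potential D \<phi>" "p \<notin> crossings D"
  shows "\<exists>N. open N \<and> p \<in> N \<and> (\<forall>z\<in>N - D. \<forall>w\<in>N - D. \<bar>\<phi> z - \<phi> w\<bar> \<le> 1)"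
  using assms unfolding face_potential_def by blast

text \<open>
  Between two consecutive encounters with \<open>D\<close> the path stays in one face, and an encounter away from
  the crossings costs at most one. The induction removes the first encounter.
\<close>

lemma face_potential_path:
  fixes m :: "real \<Rightarrow> complex"
  assumes pot: "face_potential D \<phi>"
    and "a \<le> b" "continuous_on {a..b} m" "m a \<notin> D" "m b \<notin> D"
    and "m ` {a..b} \<inter> crossings D = {}" "finite {t\<in>{a..b}. m t \<in> D}"
  shows "\<bar>\<phi> (m a) - \<phi> (m b)\<bar> \<le> int (card {t\<in>{a..b}. m t \<in> D})"
  using assms(2-)
proof (induction "card {t\<in>{a..b}. m t \<in> D}" arbitrary: a)
  case 0
  then have "{t\<in>{a..b}. m t \<in> D} = {}" by simp
  then have "m ` {a..b} \<inter> D = {}" by auto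
  moreover have "connected (m ` {a..b})" using 0 by (intro connected_continuous_image) auto
  ultimately have "\<phi> (m a) = \<phi> (m b)"
    using face_potential_const[OF pot] \<open>a \<le> b\<close> by (metis atLeastAtMost_iff image_eqI order_refl)
  then show ?case by simp
next
  case (Suc n)
  let ?T = "{t\<in>{a..b}. m t \<in> D}"
  define t where "t = Min ?T"
  have ne: "?T \<noteq> {}" using Suc.hyps(2) by (metis card.empty nat.distinct(1))
  have tT: "t \<in> ?T" unfolding t_def using Min_in[OF Suc.prems(6) ne] .
  have tmin: "t \<le> s" if "s \<in> ?T" for s unfolding t_def using Suc.prems(6) that by simp
  have ab: "a < t" "t < b" using tT Suc.prems by (auto simp: order_less_le)
  have "m t \<notin> crossings D" using Suc.prems(5) tT by blast
  from face_potential_jump[OF pot this] obtain N where N: "open N" "m t \<in> N"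
    and jump: "\<forall>z\<in>N - D. \<forall>w\<in>N - D. \<bar>\<phi> z - \<phi> w\<bar> \<le> 1" by blast
  obtain e where e: "0 < e" and eN: "\<And>s. s \<in> {a..b} \<Longrightarrow> \<bar>s - t\<bar> < e \<Longrightarrow> m s \<in> N"
  proof -
    obtain d where d: "0 < d" "ball (m t) d \<subseteq> N" using N by (meson openE)
    have "t \<in> {a..b}" using tT by simp
    then have "\<exists>e>0. \<forall>s\<in>{a..b}. dist s t < e \<longrightarrow> dist (m s) (m t) < d"
      using Suc.prems(2) d(1) unfolding continuous_on_iff by blast
    then obtain e where "0 < e" "\<forall>s\<in>{a..b}. dist s t < e \<longrightarrow> dist (m s) (m t) < d" by blast
    then show thesis using d that[of e] by (simp add: dist_real_def dist_commute subset_iff)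
  qed
  define rest where "rest = ?T - {t}"
  have frest: "finite rest" "card rest = n"
    using Suc.prems(6) Suc.hyps(2) tT by (auto simp: rest_def)
  \<comment> \<open>The next parameter at which the path meets \<open>D\<close>, or the end of the path.\<close>
  define u where "u = Min (insert b rest)"
  have u: "t < u" "u \<le> b" "\<And>s. s \<in> rest \<Longrightarrow> u \<le> s"
  proof -
    have "\<And>s. s \<in> rest \<Longrightarrow> t < s" using tmin by (fastforce simp: rest_def)
    then show "t < u" using ab frest unfolding u_def by (subst Min_gr_iff) auto
    show "u \<le> b" "\<And>s. s \<in> rest \<Longrightarrow> u \<le> s" using frest unfolding u_def by auto
  qed
  define t1 where "t1 = max ((a + t) / 2) (t - e/2)"
  define t2 where "t2 = min ((u + t) / 2) (t + e/2)"
  have t1: "a < t1" "t1 < t" "\<bar>t1 - t\<bar> < e" using ab e by (auto simp: t1_def field_simps max_def abs_if)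
  have t2: "t < t2" "t2 < u" "\<bar>t2 - t\<bar> < e" using u e by (auto simp: t2_def field_simps min_def abs_if)
  have noD: "m s \<notin> D" if "s \<in> {a..b}" "s < u" "s \<noteq> t" for s
    using u(3)[of s] that by (auto simp: rest_def)
  have T2: "{s\<in>{t2..b}. m s \<in> D} = rest"
  proof (intro set_eqI iffI)
    fix s assume s: "s \<in> {s\<in>{t2..b}. m s \<in> D}"
    then have "s \<in> ?T" "s \<noteq> t" using t2 ab by auto
    then show "s \<in> rest" by (simp add: rest_def)
  next
    fix s assume s: "s \<in> rest"
    then have "u \<le> s" "s \<in> ?T" using u by (auto simp: rest_def)
    then show "s \<in> {s\<in>{t2..b}. m s \<in> D}" using t2 by auto
  qed
  have "\<phi> (m a) = \<phi> (m t1)"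
  proof (rule face_potential_const[OF pot])
    show "connected (m ` {a..t1})"
      using Suc.prems t1 ab by (intro connected_continuous_image) (auto intro: continuous_on_subset)
    show "m ` {a..t1} \<inter> D = {}"
    proof -
      have "m s \<notin> D" if "s \<in> {a..t1}" for s using noD[of s] that t1 ab u by auto
      then show ?thesis by blast
    qed
  qed (use t1 in auto)
  moreover have "\<bar>\<phi> (m t1) - \<phi> (m t2)\<bar> \<le> 1"
  proof -
    have "m t1 \<in> N - D" "m t2 \<in> N - D"
      using eN[of t1] eN[of t2] noD[of t1] noD[of t2] t1 t2 ab u by auto
    then show ?thesis using jump by blast
  qed
  moreover have "\<bar>\<phi> (m t2) - \<phi> (m b)\<bar> \<le> int n"
  proof -
    have "\<bar>\<phi> (m t2) - \<phi> (m b)\<bar> \<le> int (card {s\<in>{t2..b}. m s \<in> D})"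
    proof (rule Suc.hyps(1))
      show "n = card {s \<in> {t2..b}. m s \<in> D}" using T2 frest by simp
      show "finite {s \<in> {t2..b}. m s \<in> D}" using T2 frest by simp
      show "continuous_on {t2..b} m" using Suc.prems(2) ab t2 by (auto intro: continuous_on_subset)
      show "m ` {t2..b} \<inter> crossings D = {}"
      proof -
        have "{t2..b} \<subseteq> {a..b}" using ab t2 by auto
        then show ?thesis using Suc.prems(5) by blast
      qed
      show "m t2 \<notin> D" using noD[of t2] t2 ab u by auto
    qed (use Suc.prems t2 u in auto)
    then show ?thesis using T2 frest by simp
  qed
  ultimately show ?case using Suc.hyps(2) by linarith
qed

lemma face_potential_outside:
  assumes "compact D" "face_potential D \<phi>" "\<And>z. norm z > B \<Longrightarrow> \<phi> z = k" "z \<in> outside D"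
  shows "\<phi> z = k"
proof -
  have bd: "bounded D" using assms compact_imp_bounded by blast
  have "\<not> bounded (outside D)" using bd unbounded_outside by blast
  then obtain w where w: "w \<in> outside D" "norm w > B" unfolding bounded_iff by (meson not_le)
  have "connected (outside D)" using bd by (simp add: connected_outside)
  then have "\<phi> z = \<phi> w"
    using face_potential_const[OF assms(2)] w assms(4) outside_no_overlap[of D] by (metis inf_commute)
  then show ?thesis using assms(3) w by simp
qed

text \<open>
  This bounds the wrapping number from below by the value of a potential far away.
\<close>

lemma meridian_ge_potential:
  assumes D: "compact D" and pot: "face_potential D \<phi>" and c: "\<phi> c = 0" "c \<notin> D"
    and far: "\<And>z. norm z > B \<Longrightarrow> \<phi> z = int n" and m: "meridian c D m"
  shows "n \<le> card (path_image m \<inter> D)"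
proof -
  have arc: "inj_on m {0..1}" "continuous_on {0..1} m" and ends: "m 0 = c" "m 1 \<in> outside D"
    and fin: "finite (path_image m \<inter> D)" and cr: "m ` {0..1} \<inter> crossings D = {}"
    using m by (auto simp: meridian_def arc_def path_def pathstart_def pathfinish_def path_image_def)
  have bij: "bij_betw m {t\<in>{0..1}. m t \<in> D} (path_image m \<inter> D)"
    using arc by (auto simp: bij_betw_def path_image_def inj_on_def)
  have "\<bar>\<phi> (m 0) - \<phi> (m 1)\<bar> \<le> int (card {t\<in>{0..1}. m t \<in> D})"
  proof (rule face_potential_path[OF pot])
    show "m 1 \<notin> D" using ends outside_no_overlap by blast
    show "finite {t \<in> {0..1}. m t \<in> D}" using bij fin bij_betw_finite by blast
  qed (use arc ends c cr in auto)
  then show ?thesis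
    using face_potential_outside[OF D pot far ends(2)] c ends bij_betw_same_card[OF bij] by simp
qed

section \<open>The cross and its splitting\<close>

text \<open>
  By invariance of domain, an injective continuous map to the plane that straightens \<open>D\<close> near \<open>p\<close>
  already provides a coordinate disc.
\<close>

lemma regular_of_injection:
  assumes "open V" "p \<in> V" "continuous_on V F" "inj_on F V" "F p = 0"
    and "\<And>z. z \<in> V \<Longrightarrow> z \<in> D \<longleftrightarrow> Im (F z) = 0"
  shows "regular D p"
proof -
  obtain G where "homeomorphism V (F ` V) F G"
    using invariance_of_domain_homeomorphism[of V F] assms by auto
  moreover have "open (F ` V)" using invariance_of_domain assms by blast
  ultimately show ?thesis
    using regular_of_homeomorphism[of V "F ` V" F G p D] assms by (simp add: real_axis_def)
qed

lemma chart_rotate: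
  assumes ch: "chart p U h" and u: "norm u = 1"
  shows "chart p U (\<lambda>z. u * h z)"
proof -
  obtain g where g: "homeomorphism U (ball 0 1) h g"
    using ch by (auto simp: chart_def)
  have "homeomorphism U (ball 0 1) (\<lambda>z. u * h z) (\<lambda>w. g (w / u))"
  proof (rule homeomorphismI)
    have n: "w / u \<in> ball 0 1" if "w \<in> ball 0 1" for w using that u by (simp add: norm_divide)
    show "continuous_on U (\<lambda>z. u * h z)" using g by (auto simp: homeomorphism_def intro!: continuous_intros)
    show "continuous_on (ball 0 1) (\<lambda>w. g (w / u))"
      by (rule continuous_on_compose2[of "ball 0 1" g])
         (use g n u in \<open>auto simp: homeomorphism_def intro!: continuous_intros\<close>)
    show "(\<lambda>z. u * h z) ` U \<subseteq> ball 0 1" using g u by (auto simp: homeomorphism_def norm_mult)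
    show "(\<lambda>w. g (w / u)) ` ball 0 1 \<subseteq> U" using g n by (auto simp: homeomorphism_def)
    show "g (u * h z / u) = z" if "z \<in> U" for z
      using g that u by (auto simp: homeomorphism_def)
    show "u * h (g (w / u)) = w" if "w \<in> ball 0 1" for w
    proof -
      have "h (g (w / u)) = w / u" using g n[OF that] by (auto simp: homeomorphism_def)
      then show ?thesis using u by auto
    qed
  qed
  then show ?thesis using ch by (auto simp: chart_def)
qed

abbreviation axes :: "complex set" where
  "axes \<equiv> real_axis \<union> imag_axis"

lemma axes_iff: "w \<in> axes \<longleftrightarrow> Re w = 0 \<or> Im w = 0"
  by (auto simp: real_axis_def imag_axis_def)

text \<open>
  Multiplication by these numbers permutes the half-axes and the quadrants. It reduces statements
  about all of them to the positive real axis and the first quadrant.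
\<close>

definition units :: "complex set" where
  "units = {1, \<i>, -1, -\<i>}"

lemma units_invariant:
  assumes "u \<in> units"
  shows "norm u = 1" "\<i> * u \<in> units" "cnj u * u = 1" "u * w \<in> axes \<longleftrightarrow> w \<in> axes"
    "u * w \<in> diamond \<longleftrightarrow> w \<in> diamond"
  using assms unfolding axes_iff units_def by (auto simp: diamond_def add.commute)

lemma units_half_axis:
  assumes "w \<in> axes" "w \<noteq> 0"
  obtains u where "u \<in> units" "0 < Re (u * w)" "Im (u * w) = 0"
proof -
  have "\<exists>u\<in>units. 0 < Re (u * w) \<and> Im (u * w) = 0"
    using assms unfolding units_def axes_iff complex_eq_iff by (simp, linarith)
  then show thesis using that by blast
qed

lemma units_quadrant:
  assumes "w \<notin> axes"
  obtains u where "u \<in> units" "0 < Re (u * w)" "0 < Im (u * w)"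
proof -
  have "\<exists>u\<in>units. 0 < Re (u * w) \<and> 0 < Im (u * w)"
    using assms unfolding units_def axes_iff by (simp, linarith)
  then show thesis using that by blast
qed

lemma units_quadrant_unique:
  assumes "u \<in> units" "v \<in> units" "0 < Re (u * w)" "0 < Im (u * w)" "0 < Re (v * w)" "0 < Im (v * w)"
  shows "u = v"
  using assms by (auto simp: units_def)

lemma diamond_subset_ball: "diamond \<subseteq> ball 0 1"
proof
  fix z assume "z \<in> diamond"
  then have "\<bar>Re z\<bar> + \<bar>Im z\<bar> \<le> 1/2" by (simp add: diamond_def)
  then show "z \<in> ball 0 1" using cmod_le[of z] by simp
qed

lemma compact_diamond: "compact diamond"
proof -
  have "closed diamond" unfolding diamond_def by (intro closed_Collect_le continuous_intros)
  moreover have "bounded diamond" using diamond_subset_ball bounded_ball bounded_subset by blast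
  ultimately show ?thesis by (simp add: compact_eq_bounded_closed)
qed

lemma split_cross_off_diamond: "w \<notin> diamond \<Longrightarrow> w \<in> split_cross \<longleftrightarrow> w \<in> axes"
  unfolding split_cross_def by (auto simp: diamond_def)

text \<open>
  In the coordinates \<open>Re w - Im w\<close> and \<open>Re w + Im w\<close> the split cross is the union of a function
  graph and its mirror image. Subtracting the function straightens it, so that all its points are
  regular, the corners of the diamond included.
\<close>

lemma split_cross_graph:
  "w \<in> split_cross \<longleftrightarrow> \<bar>Re w + Im w\<bar> = max \<bar>Re w - Im w\<bar> (1/2)"
proof -
  define x y where "x = Re w" and "y = Im w"
  have "w \<in> split_cross \<longleftrightarrow> (x = 0 \<or> y = 0) \<and> 1/2 < \<bar>x\<bar> + \<bar>y\<bar> \<or> \<bar>x\<bar> + \<bar>y\<bar> = 1/2 \<and> 0 \<le> x * y"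
    unfolding split_cross_def Un_iff Diff_iff x_def y_def
    by (auto simp: diamond_def real_axis_def imag_axis_def)
  also have "0 \<le> x * y \<longleftrightarrow> (0 \<le> x \<and> 0 \<le> y) \<or> (x \<le> 0 \<and> y \<le> 0)"
    by (auto simp: zero_le_mult_iff)
  also have "(x = 0 \<or> y = 0) \<and> 1/2 < \<bar>x\<bar> + \<bar>y\<bar> \<or>
      \<bar>x\<bar> + \<bar>y\<bar> = 1/2 \<and> ((0 \<le> x \<and> 0 \<le> y) \<or> (x \<le> 0 \<and> y \<le> 0)) \<longleftrightarrow>
      \<bar>x + y\<bar> = max \<bar>x - y\<bar> (1/2)"
    by (smt (verit) field_sum_of_halves)
  finally show ?thesis by (simp add: x_def y_def)
qed

lemma regular_half_axis:
  assumes ch: "chart p U h" and L: "looks_like D U h axes"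
    and z: "z \<in> U" "0 < Re (h z)" "Im (h z) = 0"
  shows "regular D z"
proof (rule regular_of_injection)
  obtain g where g: "homeomorphism U (ball 0 1) h g" and U: "open U" using ch by (auto simp: chart_def)
  have ch': "continuous_on U h" using g by (auto simp: homeomorphism_def)
  have inj: "inj_on h U" using g by (metis homeomorphism_apply1 inj_onI)
  have "{z \<in> U. 0 < Re (h z)} = U \<inter> h -` {w. 0 < Re w}" by auto
  moreover have "open {w. 0 < Re w}" by (intro open_Collect_less continuous_intros)
  ultimately show "open {z \<in> U. 0 < Re (h z)}"
    using continuous_open_preimage[OF ch' U] by metis
  show "continuous_on {z \<in> U. 0 < Re (h z)} (\<lambda>w. h w - h z)"
    by (intro continuous_intros continuous_on_subset[OF ch']) auto
  show "inj_on (\<lambda>w. h w - h z) {z \<in> U. 0 < Re (h z)}"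
    using inj by (auto simp: inj_on_def)
  show "w \<in> D \<longleftrightarrow> Im (h w - h z) = 0" if "w \<in> {z \<in> U. 0 < Re (h z)}" for w
    using L that z unfolding looks_like_iff[OF ch] axes_iff by auto
qed (use z in auto)

lemma regular_split_cross:
  assumes ch: "chart p U h" and L: "\<And>z. z \<in> U \<Longrightarrow> z \<in> D \<longleftrightarrow> h z \<in> split_cross"
    and z: "z \<in> U" "z \<in> D"
  shows "regular D z"
proof -
  have *: "regular D z" if ch: "chart p U h" and L: "\<And>z. z \<in> U \<Longrightarrow> z \<in> D \<longleftrightarrow> h z \<in> split_cross"
    and t: "0 < Re (h z) + Im (h z)" for h
  proof (rule regular_of_injection)
    let ?V = "{z \<in> U. 0 < Re (h z) + Im (h z)}"
    \<comment> \<open>The coordinates in which the split cross is a graph, sheared so that the graph becomes an axis.\<close>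
    define G where "G w = Complex (Re w - Im w) (Re w + Im w - max \<bar>Re w - Im w\<bar> (1/2))" for w
    obtain g where g: "homeomorphism U (ball 0 1) h g" and U: "open U" using ch by (auto simp: chart_def)
    have ch': "continuous_on U h" using g by (auto simp: homeomorphism_def)
    have inj: "inj_on h U" using g by (metis homeomorphism_apply1 inj_onI)
    have "?V = U \<inter> h -` {w. 0 < Re w + Im w}" by auto
    moreover have "open {w. 0 < Re w + Im w}" by (intro open_Collect_less continuous_intros)
    ultimately show "open ?V"
      using continuous_open_preimage[OF ch' U] by metis
    have G: "continuous_on UNIV G"
      unfolding G_def Complex_eq by (intro continuous_intros)
    show "continuous_on ?V (\<lambda>w. G (h w) - G (h z))"
    proof (intro continuous_intros)
      show "continuous_on ?V (\<lambda>w. G (h w))"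
        by (rule continuous_on_compose2[OF G]) (auto intro: continuous_on_subset[OF ch'])
    qed
    have Ginj: "w = w'" if "G w = G w'" for w w'
      using that unfolding G_def by (auto simp: complex_eq_iff)
    show "inj_on (\<lambda>w. G (h w) - G (h z)) ?V"
      using inj Ginj by (auto simp: inj_on_def)
    have "h z \<in> split_cross" using L z by simp
    then have "Im (G (h z)) = 0" using t by (simp add: G_def split_cross_graph)
    then show "w \<in> D \<longleftrightarrow> Im (G (h w) - G (h z)) = 0" if "w \<in> ?V" for w
      using that L[of w] by (simp add: G_def split_cross_graph)
  qed (use z t in auto)
  have "h z \<in> split_cross" using L z by simp
  then have "\<bar>Re (h z) + Im (h z)\<bar> \<ge> 1/2" by (auto simp: split_cross_graph)
  then consider "0 < Re (h z) + Im (h z)" | "0 < Re (- 1 * h z) + Im (- 1 * h z)" by fastforce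
  then show ?thesis
  proof cases
    case 1 then show ?thesis using * ch L by blast
  next
    case 2
    show ?thesis
    proof (rule *[OF chart_rotate[OF ch] _ 2])
      show "w \<in> D \<longleftrightarrow> - 1 * h w \<in> split_cross" if "w \<in> U" for w
        using L[OF that] unfolding split_cross_graph by (simp add: abs_if max_def) argo
    qed simp
  qed
qed

section \<open>Splitting crossings of a diagram\<close>

text \<open>
  The splittings of a diagram need not be images of a single circle, so that the procedure leaves the
  class of knot diagrams. This is the local description that it preserves.
\<close>

definition tame :: "complex set \<Rightarrow> bool" where
  "tame D \<longleftrightarrow> compact D \<and> finite (crossings D) \<and> (\<forall>p\<in>D. p \<in> crossings D \<or> regular D p)"

text \<open>
  Splitting of a set \<open>X\<close> of crossings in disjoint coordinate discs, without reference to a region.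
\<close>

locale splitting =
  fixes D X :: "complex set" and U :: "complex \<Rightarrow> complex set" and f :: "complex \<Rightarrow> complex \<Rightarrow> complex"
    and D' :: "complex set"
  assumes tame: "tame D" and X: "X \<subseteq> crossings D"
    and chart: "x \<in> X \<Longrightarrow> chart x (U x) (f x)"
    and cross: "x \<in> X \<Longrightarrow> looks_like D (U x) (f x) axes"
    and disj: "disjoint_family_on U X"
    and D'_eq: "D' = (D - (\<Union>x\<in>X. U x)) \<union> (\<Union>x\<in>X. {z \<in> U x. f x z \<in> split_cross})"
begin

definition \<Delta> :: "complex set" where
  "\<Delta> = (\<Union>x\<in>X. {z \<in> U x. f x z \<in> diamond})"

text \<open>
  The quadrant of the disc at \<open>x\<close> that multiplication by \<open>u\<close> turns into the first one: the second and
  fourth quadrants, which a splitting merges, are those for \<open>-\<i>\<close> and \<open>\<i>\<close>.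
\<close>

definition quad :: "complex \<Rightarrow> complex \<Rightarrow> complex set" where
  "quad x u = {z \<in> U x. 0 < Re (u * f x z) \<and> 0 < Im (u * f x z)}"

lemma finite_X: "finite X"
  using tame X finite_subset by (auto simp: tame_def)

lemma same_disc: "x \<in> X \<Longrightarrow> y \<in> X \<Longrightarrow> z \<in> U x \<Longrightarrow> z \<in> U y \<Longrightarrow> x = y"
  using disj by (auto simp: disjoint_family_on_def)

lemma D_in_disc: "x \<in> X \<Longrightarrow> z \<in> U x \<Longrightarrow> z \<in> D \<longleftrightarrow> f x z \<in> axes"
proof -
  assume x: "x \<in> X" and z: "z \<in> U x"
  have "\<forall>z\<in>U x. z \<in> D \<longleftrightarrow> f x z \<in> axes"
    using cross[OF x] by (simp only: looks_like_iff[OF chart[OF x]])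
  then show "z \<in> D \<longleftrightarrow> f x z \<in> axes" using z by (rule bspec)
qed

lemma D'_in_disc: "x \<in> X \<Longrightarrow> z \<in> U x \<Longrightarrow> z \<in> D' \<longleftrightarrow> f x z \<in> split_cross"
  unfolding D'_eq using same_disc by blast

lemma \<Delta>_in_disc: "x \<in> X \<Longrightarrow> z \<in> U x \<Longrightarrow> z \<in> \<Delta> \<longleftrightarrow> f x z \<in> diamond"
  unfolding \<Delta>_def using same_disc by blast

lemma off_\<Delta>: "z \<notin> \<Delta> \<Longrightarrow> z \<in> D' \<longleftrightarrow> z \<in> D"
proof (cases "\<exists>x\<in>X. z \<in> U x")
  case True
  assume "z \<notin> \<Delta>"
  then show ?thesis using True D_in_disc D'_in_disc \<Delta>_in_disc split_cross_off_diamond by metis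
next
  case False
  then show ?thesis unfolding D'_eq by auto
qed

lemma obtain_inverse:
  assumes "x \<in> X"
  obtains g where "continuous_on (ball 0 1) g" "continuous_on (U x) (f x)"
    "\<And>z. z \<in> U x \<Longrightarrow> g (f x z) = z" "\<And>w. norm w < 1 \<Longrightarrow> f x (g w) = w"
    "\<And>w. norm w < 1 \<Longrightarrow> g w \<in> U x" "\<And>z. z \<in> U x \<Longrightarrow> norm (f x z) < 1"
proof -
  obtain g where g: "homeomorphism (U x) (ball 0 1) (f x) g" using chart[OF assms] by (auto simp: chart_def)
  show thesis by (rule that[of g]) (use g in \<open>auto simp: homeomorphism_def\<close>)
qed

lemma open_disc: "x \<in> X \<Longrightarrow> open (U x)"
  using chart by (auto simp: chart_def)

lemma open_preimage:
  assumes "x \<in> X" "open S" shows "open {z \<in> U x. f x z \<in> S}"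
proof -
  obtain g where "continuous_on (U x) (f x)" using obtain_inverse[OF assms(1)] .
  then have "open (U x \<inter> f x -` S)" using continuous_open_preimage open_disc assms by blast
  moreover have "U x \<inter> f x -` S = {z \<in> U x. f x z \<in> S}" by auto
  ultimately show ?thesis by simp
qed

lemma compact_preimage:
  assumes "x \<in> X" "compact S" "S \<subseteq> ball 0 1" shows "compact {z \<in> U x. f x z \<in> S}"
proof -
  obtain g where g: "continuous_on (ball 0 1) g" "\<And>z. z \<in> U x \<Longrightarrow> g (f x z) = z"
     "\<And>w. norm w < 1 \<Longrightarrow> f x (g w) = w" "\<And>w. norm w < 1 \<Longrightarrow> g w \<in> U x"
    using obtain_inverse[OF assms(1)] by metis
  have "{z \<in> U x. f x z \<in> S} = g ` S"
  proof (intro equalityI subsetI)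
    fix z assume "z \<in> {z \<in> U x. f x z \<in> S}"
    then show "z \<in> g ` S" using g(2)[of z] by force
  next
    fix z assume "z \<in> g ` S"
    then obtain w where w: "w \<in> S" "z = g w" by blast
    then have "norm w < 1" using assms(3) by auto
    then show "z \<in> {z \<in> U x. f x z \<in> S}" using g w by simp
  qed
  moreover have "compact (g ` S)"
    using assms g(1) by (meson compact_continuous_image continuous_on_subset)
  ultimately show ?thesis by simp
qed

lemma compact_\<Delta>: "compact \<Delta>"
  unfolding \<Delta>_def using finite_X compact_preimage compact_diamond diamond_subset_ball by blast

lemma closed_\<Delta>: "closed \<Delta>"
  using compact_\<Delta> compact_imp_closed by blast

lemma compact_D: "compact D"
  using tame by (simp add: tame_def)

text \<open>
  The part of the split diagram inside an open coordinate disc is not closed. The same diagram arises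
  from \<open>D\<close> by cutting out only the interiors of the diamonds and adding the sides, and this exhibits it
  as a union of compact sets.
\<close>

lemma compact_D': "compact D'"
proof -
  define I where "I = {z. \<bar>Re z\<bar> + \<bar>Im z\<bar> < 1/2}"
  have I: "open I" unfolding I_def by (intro open_Collect_less continuous_intros)
  have S: "closed split_cross"
  proof -
    have "split_cross = {w. \<bar>Re w + Im w\<bar> = max \<bar>Re w - Im w\<bar> (1/2)}" using split_cross_graph by blast
    moreover have "closed {w. \<bar>Re w + Im w\<bar> = max \<bar>Re w - Im w\<bar> (1/2)}"
      by (intro closed_Collect_eq continuous_intros)
    ultimately show ?thesis by simp
  qed
  have eq: "D' = (D - (\<Union>x\<in>X. {z \<in> U x. f x z \<in> I})) \<union> (\<Union>x\<in>X. {z \<in> U x. f x z \<in> diamond \<inter> split_cross})"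
    (is "_ = ?A \<union> ?B")
  proof (intro set_eqI)
    fix z
    show "z \<in> D' \<longleftrightarrow> z \<in> ?A \<union> ?B"
    proof (cases "\<exists>x\<in>X. z \<in> U x")
      case True
      then obtain x where x: "x \<in> X" "z \<in> U x" by blast
      then have "z \<in> ?A \<union> ?B \<longleftrightarrow> f x z \<in> axes \<and> f x z \<notin> I \<or> f x z \<in> diamond \<inter> split_cross"
        using same_disc D_in_disc[OF x] by blast
      also have "\<dots> \<longleftrightarrow> f x z \<in> split_cross"
        by (auto simp: I_def diamond_def split_cross_def real_axis_def imag_axis_def)
      finally show ?thesis using D'_in_disc[OF x] by simp
    next
      case False
      then show ?thesis unfolding D'_eq by blast
    qed
  qed
  have "open (\<Union>x\<in>X. {z \<in> U x. f x z \<in> I})" using open_preimage I by blast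
  then have "compact ?A" using compact_D by (simp add: compact_diff)
  moreover have "compact {z \<in> U x. f x z \<in> diamond \<inter> split_cross}" if "x \<in> X" for x
    by (rule compact_preimage[OF that]) (use compact_diamond S diamond_subset_ball in auto)
  then have "compact ?B" using finite_X by blast
  ultimately show ?thesis unfolding eq by blast
qed

text \<open>
  Splitting creates no crossings: nothing changes outside the diamonds, and inside them the new
  diagram is regular.
\<close>

lemma crossings_off_\<Delta>:
  assumes "p \<notin> \<Delta>" shows "p \<in> crossings D' \<longleftrightarrow> p \<in> crossings D"
  using crossings_local[of p D "-\<Delta>" D'] crossings_local[of p D' "-\<Delta>" D] assms closed_\<Delta> off_\<Delta>
  by (metis ComplD ComplI open_Compl)

lemma regular_in_\<Delta>:
  assumes "p \<in> \<Delta>" "p \<in> D'" shows "regular D' p"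
proof -
  obtain x where x: "x \<in> X" "p \<in> U x" using assms by (auto simp: \<Delta>_def)
  show ?thesis
    using regular_split_cross[OF chart[OF x(1)] _ x(2)] D'_in_disc[OF x(1)] assms by blast
qed

lemma crossings_D': "crossings D' \<subseteq> crossings D"
proof
  fix p assume p: "p \<in> crossings D'"
  then have "p \<notin> \<Delta>"
    using crossings_subset regular_in_\<Delta> regular_not_crossing by blast
  then show "p \<in> crossings D" using crossings_off_\<Delta> p by blast
qed

lemma tame_D': "tame D'"
proof -
  have "p \<in> crossings D' \<or> regular D' p" if "p \<in> D'" for p
  proof (cases "p \<in> \<Delta>")
    case True then show ?thesis using regular_in_\<Delta> that by blast
  next
    case False
    then have "p \<in> D" using off_\<Delta> that by blast
    then consider "p \<in> crossings D" | "regular D p" using tame by (auto simp: tame_def)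
    then show ?thesis
    proof cases
      case 1 then show ?thesis using False crossings_off_\<Delta> by blast
    next
      case 2
      have "regular D' p"
        using regular_local[OF 2, of "-\<Delta>" D'] False closed_\<Delta> off_\<Delta> by (metis ComplD ComplI open_Compl)
      then show ?thesis ..
    qed
  qed
  moreover have "finite (crossings D')"
    using crossings_D' tame finite_subset by (auto simp: tame_def)
  ultimately show ?thesis using compact_D' by (simp add: tame_def)
qed

lemma quad_disjoint_D: "x \<in> X \<Longrightarrow> u \<in> units \<Longrightarrow> quad x u \<inter> D = {}"
proof -
  assume "x \<in> X" "u \<in> units"
  have "z \<notin> D" if "z \<in> quad x u" for z
  proof -
    have z: "z \<in> U x" and "u * f x z \<notin> axes" using that unfolding quad_def axes_iff by auto
    then have "f x z \<notin> axes" using units_invariant(4)[OF \<open>u \<in> units\<close>] by blast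
    then show ?thesis using D_in_disc[OF \<open>x \<in> X\<close> z] by blast
  qed
  then show ?thesis by blast
qed

lemma open_quad: "x \<in> X \<Longrightarrow> open (quad x u)"
proof -
  assume x: "x \<in> X"
  have "open ({w. 0 < Re (u * w)} \<inter> {w. 0 < Im (u * w)})"
    by (intro open_Int open_Collect_less continuous_intros)
  from open_preimage[OF x this] show ?thesis unfolding quad_def by simp
qed

text \<open>
  A quadrant remains connected when the diamond is removed, since the diamond cuts off a corner by a
  straight line in the coordinates of the disc.
\<close>

lemma convex_sector: "convex (ball 0 1 \<inter> {w. 0 < Re w} \<inter> {w. 0 < Im w} \<inter> {w. a < Re w + Im w})"
proof -
  have "{w. 0 < Re w} = {w. inner 1 w > 0}" "{w. 0 < Im w} = {w. inner \<i> w > 0}"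
    "{w. a < Re w + Im w} = {w. inner (Complex 1 1) w > a}" by (auto simp: inner_complex_def)
  then show ?thesis by (metis convex_Int convex_ball convex_halfspace_gt)
qed

lemma connected_sector:
  assumes x: "x \<in> X" and u: "u \<in> units"
  shows "connected {z \<in> quad x u. a < Re (u * f x z) + Im (u * f x z)}"
proof -
  obtain g where g: "continuous_on (ball 0 1) g" "\<And>z. z \<in> U x \<Longrightarrow> g (f x z) = z"
     "\<And>w. norm w < 1 \<Longrightarrow> f x (g w) = w" "\<And>w. norm w < 1 \<Longrightarrow> g w \<in> U x"
     "\<And>z. z \<in> U x \<Longrightarrow> norm (f x z) < 1"
    using obtain_inverse[OF x] by metis
  let ?S = "ball 0 1 \<inter> {w. 0 < Re w} \<inter> {w. 0 < Im w} \<inter> {w. a < Re w + Im w}"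
  note uu = units_invariant(1,3)[OF u]
  have nu: "norm (cnj u * w) = norm w" "norm (u * w) = norm w" "u * (cnj u * w) = w" "cnj u * (u * w) = w" for w
    using uu by (simp_all add: norm_mult mult.assoc[symmetric] mult.commute)
  have "connected ((\<lambda>w. g (cnj u * w)) ` ?S)"
  proof (rule connected_continuous_image[OF _ convex_connected[OF convex_sector]])
    show "continuous_on ?S (\<lambda>w. g (cnj u * w))"
      by (rule continuous_on_compose2[OF g(1)]) (use nu in \<open>auto intro!: continuous_intros\<close>)
  qed
  moreover have "(\<lambda>w. g (cnj u * w)) ` ?S = {z \<in> quad x u. a < Re (u * f x z) + Im (u * f x z)}"
  proof (intro equalityI subsetI)
    fix z assume "z \<in> (\<lambda>w. g (cnj u * w)) ` ?S"
    then obtain w where w: "w \<in> ?S" "z = g (cnj u * w)" by blast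
    then have "norm (cnj u * w) < 1" using nu by simp
    then have "z \<in> U x" "u * f x z = w" using g w nu(3) by auto
    then show "z \<in> {z \<in> quad x u. a < Re (u * f x z) + Im (u * f x z)}"
      using w unfolding quad_def mem_Collect_eq by auto
  next
    fix z assume z: "z \<in> {z \<in> quad x u. a < Re (u * f x z) + Im (u * f x z)}"
    then have zU: "z \<in> U x" by (simp add: quad_def)
    have "z = g (cnj u * (u * f x z))" by (simp only: g(2)[OF zU] nu(4))
    moreover have "u * f x z \<in> ?S" using z g(5)[OF zU] nu(2) by (simp add: quad_def)
    ultimately show "z \<in> (\<lambda>w. g (cnj u * w)) ` ?S" by blast
  qed
  ultimately show ?thesis by simp
qed

lemma connected_quad: "x \<in> X \<Longrightarrow> u \<in> units \<Longrightarrow> connected (quad x u)"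
proof -
  assume *: "x \<in> X" "u \<in> units"
  have "{z \<in> quad x u. 0 < Re (u * f x z) + Im (u * f x z)} = quad x u" by (auto simp: quad_def)
  then show ?thesis using connected_sector[OF *, of 0] by simp
qed

lemma quad_off_\<Delta>:
  assumes "x \<in> X" "u \<in> units"
  shows "quad x u - \<Delta> = {z \<in> quad x u. 1/2 < Re (u * f x z) + Im (u * f x z)}"
proof -
  have "z \<in> \<Delta> \<longleftrightarrow> \<not> 1/2 < Re (u * f x z) + Im (u * f x z)" if "z \<in> quad x u" for z
  proof -
    have "z \<in> \<Delta> \<longleftrightarrow> f x z \<in> diamond" using that \<Delta>_in_disc[OF assms(1)] by (auto simp: quad_def)
    also have "\<dots> \<longleftrightarrow> u * f x z \<in> diamond" using units_invariant(5)[OF assms(2)] by simp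
    finally show ?thesis using that by (auto simp: quad_def diamond_def)
  qed
  then show ?thesis by blast
qed

lemma connected_quad_off_\<Delta>: "x \<in> X \<Longrightarrow> u \<in> units \<Longrightarrow> connected (quad x u - \<Delta>)"
  by (simp only: quad_off_\<Delta> connected_sector)

lemma quad_off_\<Delta>_nonempty:
  assumes x: "x \<in> X" and u: "u \<in> units" shows "quad x u - \<Delta> \<noteq> {}"
proof -
  obtain g where g: "\<And>w. norm w < 1 \<Longrightarrow> f x (g w) = w" "\<And>w. norm w < 1 \<Longrightarrow> g w \<in> U x"
    using obtain_inverse[OF x] by metis
  \<comment> \<open>A point of the first quadrant in the unit disc whose coordinates add up to more than \<open>1/2\<close>.\<close>
  define v where "v = Complex (2/5) (2/5)"
  have "norm v < 1" by (simp add: v_def cmod_def power2_eq_square)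
  then have n: "norm (cnj u * v) < 1" using units_invariant(1)[OF u] by (simp add: norm_mult)
  moreover have "u * (cnj u * v) = v"
    using units_invariant(3)[OF u] by (simp add: mult.assoc[symmetric] mult.commute)
  ultimately have "g (cnj u * v) \<in> {z \<in> quad x u. 1/2 < Re (u * f x z) + Im (u * f x z)}"
    using g unfolding quad_def mem_Collect_eq by (simp only:) (simp add: v_def)
  then show ?thesis using quad_off_\<Delta>[OF x u] by blast
qed

lemma in_quad:
  assumes "x \<in> X" "z \<in> U x" "z \<notin> D" obtains u where "u \<in> units" "z \<in> quad x u"
  using units_quadrant[of "f x z"] D_in_disc[OF assms(1,2)] assms by (auto simp: quad_def)

lemma quad_unique:
  assumes "x \<in> X" "y \<in> X" "u \<in> units" "v \<in> units" "z \<in> quad x u" "z \<in> quad y v"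
  shows "x = y" "u = v"
proof -
  show "x = y" using assms same_disc by (auto simp: quad_def)
  then show "u = v" using assms units_quadrant_unique by (auto simp: quad_def)
qed

section \<open>Pulling back a potential\<close>

lemma regular_on_half_axis:
  assumes x: "x \<in> X" and u: "u \<in> units" and z: "z \<in> U x" "0 < Re (u * f x z)" "Im (u * f x z) = 0"
  shows "regular D z"
proof (rule regular_half_axis[OF chart_rotate[OF chart[OF x] units_invariant(1)[OF u]] _ z])
  show "looks_like D (U x) (\<lambda>z. u * f x z) axes"
    unfolding looks_like_iff[OF chart_rotate[OF chart[OF x] units_invariant(1)[OF u]]]
      units_invariant(4)[OF u] using D_in_disc[OF x] by blast
qed

text \<open>
  Neighbouring quadrants touch at a point of their common half-axis outside the diamond, where the
  two diagrams agree. Adjacency of faces at \<open>x\<close> can thus be transferred between them.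
\<close>

lemma half_axis_point:
  assumes x: "x \<in> X" and u: "u \<in> units"
  shows "\<exists>q. q \<notin> \<Delta> \<and> q \<notin> crossings D \<and> q \<in> closure (quad x u - \<Delta>) \<and> q \<in> closure (quad x (\<i> * u) - \<Delta>)"
proof -
  obtain g where g: "continuous_on (ball 0 1) g"
     "\<And>w. norm w < 1 \<Longrightarrow> f x (g w) = w" "\<And>w. norm w < 1 \<Longrightarrow> g w \<in> U x"
    using obtain_inverse[OF x] by metis
  note uu = units_invariant(1,3)[OF u]
  \<comment> \<open>A short segment that crosses the half-axis at \<open>3/4\<close>, far enough out to miss the diamond.\<close>
  define k where "k t = g (cnj u * Complex (3/4) t)" for t
  have n: "norm (cnj u * Complex (3/4) t) < 1" if "\<bar>t\<bar> \<le> 1/8" for t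
    using cmod_le[of "Complex (3/4) t"] that uu by (simp add: norm_mult)
  have k: "k t \<in> U x" "u * f x (k t) = Complex (3/4) t" "f x (k t) = cnj u * Complex (3/4) t" if "\<bar>t\<bar> \<le> 1/8" for t
  proof -
    show "k t \<in> U x" and *: "f x (k t) = cnj u * Complex (3/4) t"
      using g n[OF that] by (auto simp: k_def)
    have "u * (cnj u * Complex (3/4) t) = (cnj u * u) * Complex (3/4) t"
      by (simp only: mult.assoc mult.commute mult.left_commute)
    then show "u * f x (k t) = Complex (3/4) t" using * uu(2) by simp
  qed
  have ck: "continuous_on {-1/8..1/8} k"
    unfolding k_def
    by (rule continuous_on_compose2[OF g(1)]) (use n in \<open>auto simp: Complex_eq intro!: continuous_intros\<close>)
  have "k t \<in> quad x u - \<Delta>" if "0 < t" "t \<le> 1/8" for t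
  proof -
    have "\<bar>t\<bar> \<le> 1/8" using that by simp
    note * = k[OF this]
    show ?thesis unfolding quad_off_\<Delta>[OF x u] unfolding quad_def mem_Collect_eq *(2) using that *(1) by simp
  qed
  moreover have "k t \<in> quad x (\<i> * u) - \<Delta>" if "t < 0" "-1/8 \<le> t" for t
  proof -
    have "\<bar>t\<bar> \<le> 1/8" using that by simp
    note * = k[OF this]
    show ?thesis unfolding quad_off_\<Delta>[OF x units_invariant(2)[OF u]]
      unfolding quad_def mem_Collect_eq mult.assoc *(2) using that *(1) by simp
  qed
  moreover have "k 0 \<in> closure T" if "\<And>t. t \<in> S \<Longrightarrow> k t \<in> T" "0 \<in> closure S" "closure S \<subseteq> {-1/8..1/8}" for S T
  proof -
    have "k ` closure S \<subseteq> closure T"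
    proof (rule image_closure_subset)
      show "continuous_on (closure S) k" using ck that(3) continuous_on_subset by blast
      show "k ` S \<subseteq> closure T" using that(1) closure_subset by blast
    qed simp
    then show ?thesis using that(2) by blast
  qed
  from this[of "{0<..<1/8}" "quad x u - \<Delta>"] this[of "{-1/8<..<0}" "quad x (\<i> * u) - \<Delta>"]
  have "k 0 \<in> closure (quad x u - \<Delta>)" "k 0 \<in> closure (quad x (\<i> * u) - \<Delta>)"
    using calculation by auto
  moreover have "k 0 \<notin> \<Delta>"
  proof -
    have "Complex (3/4) 0 \<notin> diamond" by (simp add: diamond_def)
    then have "f x (k 0) \<notin> diamond" using units_invariant(5)[OF u, of "f x (k 0)"] k(2)[of 0] by simp
    then show ?thesis using \<Delta>_in_disc[OF x] k(1)[of 0] by simp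
  qed
  moreover have "regular D (k 0)"
    by (rule regular_on_half_axis[OF x u]) (use k(1,2)[of 0] in auto)
  ultimately show ?thesis using regular_not_crossing by blast
qed

text \<open>
  Every quadrant of \<open>D\<close> at a split crossing contains points outside the diamond, where the two
  diagrams agree; a potential for \<open>D'\<close> is carried over to \<open>D\<close> by using its values there.
\<close>

definition pull_back :: "(complex \<Rightarrow> int) \<Rightarrow> complex \<Rightarrow> int" where
  "pull_back \<phi> z =
     (if z \<in> \<Delta> then \<phi> (SOME w. \<exists>x\<in>X. \<exists>u\<in>units. z \<in> quad x u \<and> w \<in> quad x u - \<Delta>) else \<phi> z)"

lemma pull_back_off_\<Delta>: "z \<notin> \<Delta> \<Longrightarrow> pull_back \<phi> z = \<phi> z"
  by (simp add: pull_back_def)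

lemma pull_back_quad:
  assumes pot: "face_potential D' \<phi>" and x: "x \<in> X" "u \<in> units" and z: "z \<in> quad x u" and w: "w \<in> quad x u - \<Delta>"
  shows "pull_back \<phi> z = \<phi> w"
proof -
  have const: "\<phi> v = \<phi> w" if "v \<in> quad x u - \<Delta>" for v
  proof (rule face_potential_const[OF pot connected_quad_off_\<Delta>[OF x] _ that w])
    show "(quad x u - \<Delta>) \<inter> D' = {}" using quad_disjoint_D[OF x] off_\<Delta> by blast
  qed
  show ?thesis
  proof (cases "z \<in> \<Delta>")
    case False
    then show ?thesis using const z by (simp add: pull_back_def)
  next
    case True
    let ?P = "\<lambda>w. \<exists>x\<in>X. \<exists>u\<in>units. z \<in> quad x u \<and> w \<in> quad x u - \<Delta>"
    have "?P w" using x z w by blast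
    then have "?P (SOME w. ?P w)" by (rule someI)
    then obtain y v where y: "y \<in> X" "v \<in> units" "z \<in> quad y v" "(SOME w. ?P w) \<in> quad y v - \<Delta>"
      by blast
    have "y = x" "v = u"
      using quad_unique[OF y(1) x(1) y(2) x(2) y(3) z] by auto
    then have "(SOME w. ?P w) \<in> quad x u - \<Delta>" using y(4) by simp
    then show ?thesis using const True by (simp add: pull_back_def)
  qed
qed

text \<open>
  Inside a diamond only the jump across a half-axis needs attention, and it equals the jump across
  the part of that half-axis outside the diamond. The crossing itself, where opposite quadrants may
  differ by two, is exempt.
\<close>

lemma face_potential_pull_back:
  assumes pot: "face_potential D' \<phi>"
  shows "face_potential D (pull_back \<phi>)"
proof -
  have local: "\<exists>N. open N \<and> z \<in> N \<and> (\<forall>w\<in>N. pull_back \<phi> w = pull_back \<phi> z)" if z: "z \<notin> D" for z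
  proof (cases "z \<in> \<Delta>")
    case True
    then obtain x where x: "x \<in> X" "z \<in> U x" by (auto simp: \<Delta>_def)
    obtain u where u: "u \<in> units" "z \<in> quad x u" using in_quad[OF x z] by blast
    obtain v where "v \<in> quad x u - \<Delta>" using quad_off_\<Delta>_nonempty[OF x(1) u(1)] by blast
    then have "\<forall>w\<in>quad x u. pull_back \<phi> w = pull_back \<phi> z"
      using pull_back_quad[OF pot x(1) u(1)] u(2) by metis
    then show ?thesis using open_quad[OF x(1)] u(2) by blast
  next
    case False
    have "open (- \<Delta> - D)" using closed_\<Delta> compact_imp_closed[OF compact_D] by (intro open_Diff open_Compl)
    then obtain e where e: "0 < e" "ball z e \<subseteq> - \<Delta> - D" using False z by (meson ComplI DiffI openE)
    then have "ball z e \<inter> D' = {}" using off_\<Delta> by blast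
    then have "\<phi> w = \<phi> z" if "w \<in> ball z e" for w
      using face_potential_const[OF pot connected_ball _ that, of z] e by simp
    then have "\<forall>w\<in>ball z e. pull_back \<phi> w = pull_back \<phi> z"
      using e False pull_back_off_\<Delta> by (metis ComplD DiffD1 subsetD)
    then show ?thesis using e(1) by (meson centre_in_ball open_ball)
  qed
  have const: "pull_back \<phi> z = pull_back \<phi> w"
    if A: "connected A" "A \<inter> D = {}" "z \<in> A" "w \<in> A" for A z w
  proof (rule connected_local_const[OF A(1,3,4)], intro ballI)
    fix a assume "a \<in> A"
    then obtain N where "open N" "a \<in> N" "\<forall>w\<in>N. pull_back \<phi> w = pull_back \<phi> a"
      using local A(2) by blast
    then show "\<forall>\<^sub>F b in at a within A. pull_back \<phi> a = pull_back \<phi> b"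
      unfolding eventually_at_topological by metis
  qed
  have jump: "\<exists>N. open N \<and> p \<in> N \<and> (\<forall>z\<in>N - D. \<forall>w\<in>N - D. \<bar>pull_back \<phi> z - pull_back \<phi> w\<bar> \<le> 1)"
    if p: "p \<notin> crossings D" for p
  proof (cases "p \<in> D")
    case False
    then obtain N where N: "open N" "p \<in> N" "\<forall>w\<in>N. pull_back \<phi> w = pull_back \<phi> p" using local by blast
    have "\<bar>pull_back \<phi> z - pull_back \<phi> w\<bar> \<le> 1" if "z \<in> N" "w \<in> N" for z w
    proof -
      have "pull_back \<phi> z = pull_back \<phi> w" using N(3) that by metis
      then show ?thesis by simp
    qed
    then show ?thesis using N by blast
  next
    case pD: True
    show ?thesis
    proof (cases "p \<in> \<Delta>")
      case False
      then have "p \<notin> crossings D'" using p crossings_off_\<Delta> by blast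
      from face_potential_jump[OF pot this] obtain N where
        N: "open N" "p \<in> N" "\<forall>z\<in>N - D'. \<forall>w\<in>N - D'. \<bar>\<phi> z - \<phi> w\<bar> \<le> 1" by blast
      show ?thesis
      proof (intro exI conjI)
        show "open (N - \<Delta>)" "p \<in> N - \<Delta>" using N closed_\<Delta> False by auto
        show "\<forall>z\<in>N - \<Delta> - D. \<forall>w\<in>N - \<Delta> - D. \<bar>pull_back \<phi> z - pull_back \<phi> w\<bar> \<le> 1"
        proof (intro ballI)
          fix z w assume "z \<in> N - \<Delta> - D" "w \<in> N - \<Delta> - D"
          then have "z \<in> N - D'" "w \<in> N - D'" "z \<notin> \<Delta>" "w \<notin> \<Delta>" using off_\<Delta> by blast+
          then show "\<bar>pull_back \<phi> z - pull_back \<phi> w\<bar> \<le> 1" using N(3) pull_back_off_\<Delta> by simp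
        qed
      qed
    next
      case True
      then obtain x where x: "x \<in> X" "p \<in> U x" by (auto simp: \<Delta>_def)
      have "p \<noteq> x" using p x X by blast
      moreover have "f x x = 0" "x \<in> U x" using chart[OF x(1)] by (auto simp: chart_def)
      moreover obtain g where g: "\<And>z. z \<in> U x \<Longrightarrow> g (f x z) = z" using obtain_inverse[OF x(1)] by metis
      ultimately have "f x p \<noteq> 0" using g[OF x(2)] g[of x] by auto
      then obtain u where u: "u \<in> units" "0 < Re (u * f x p)" "Im (u * f x p) = 0"
        using units_half_axis[of "f x p"] D_in_disc[OF x] pD by metis
      note iu = units_invariant(2)[OF u(1)]
      obtain q where q: "q \<notin> \<Delta>" "q \<notin> crossings D" "q \<in> closure (quad x u - \<Delta>)"
        "q \<in> closure (quad x (\<i> * u) - \<Delta>)" using half_axis_point[OF x(1) u(1)] by blast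
      then have "q \<notin> crossings D'" using crossings_off_\<Delta> by blast
      from face_potential_jump[OF pot this] obtain N where
        N: "open N" "q \<in> N" "\<forall>z\<in>N - D'. \<forall>w\<in>N - D'. \<bar>\<phi> z - \<phi> w\<bar> \<le> 1" by blast
      obtain a where a: "a \<in> N" "a \<in> quad x u - \<Delta>"
        using q(3) N(1,2) unfolding closure_iff_nhds_not_empty by blast
      obtain b where b: "b \<in> N" "b \<in> quad x (\<i> * u) - \<Delta>"
        using q(4) N(1,2) unfolding closure_iff_nhds_not_empty by blast
      have "a \<notin> D'" "b \<notin> D'"
        using a b quad_disjoint_D[OF x(1) u(1)] quad_disjoint_D[OF x(1) iu] off_\<Delta> by blast+
      then have ab: "\<bar>\<phi> a - \<phi> b\<bar> \<le> 1" using N(3) a(1) b(1) by blast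
      let ?N = "{z \<in> U x. f x z \<in> {w. 0 < Re (u * w)}}"
      have "pull_back \<phi> z \<in> {\<phi> a, \<phi> b}" if z: "z \<in> ?N - D" for z
      proof -
        have "z \<in> U x" "z \<notin> D" "0 < Re (u * f x z)" using z by auto
        moreover have "u * f x z \<notin> axes"
          using D_in_disc[OF x(1), of z] units_invariant(4)[OF u(1)] calculation by blast
        then have "Im (u * f x z) \<noteq> 0" unfolding axes_iff by blast
        ultimately have "z \<in> quad x u \<or> z \<in> quad x (\<i> * u)"
          unfolding quad_def mem_Collect_eq mult.assoc by auto
        then show ?thesis
          using pull_back_quad[OF pot x(1) u(1) _ a(2)] pull_back_quad[OF pot x(1) iu _ b(2)] by blast
      qed
      note vals = this
      have "\<forall>z\<in>?N - D. \<forall>w\<in>?N - D. \<bar>pull_back \<phi> z - pull_back \<phi> w\<bar> \<le> 1"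
      proof (intro ballI)
        fix z w assume "z \<in> ?N - D" "w \<in> ?N - D"
        then have "pull_back \<phi> z \<in> {\<phi> a, \<phi> b}" "pull_back \<phi> w \<in> {\<phi> a, \<phi> b}" using vals by blast+
        then show "\<bar>pull_back \<phi> z - pull_back \<phi> w\<bar> \<le> 1" using ab by auto
      qed
      moreover have "open ?N"
        by (rule open_preimage[OF x(1)]) (intro open_Collect_less continuous_intros)
      moreover have "p \<in> ?N" using x u by simp
      ultimately show ?thesis by blast
    qed
  qed
  show ?thesis unfolding face_potential_def using const jump by blast
qed

end

section \<open>Chains of adjacent faces\<close>

lemma far_points_outside:
  fixes C :: "complex set"
  assumes "bounded C" shows "\<exists>B. \<forall>z. B < norm z \<longrightarrow> z \<in> outside C"
proof -
  have "bounded (C \<union> inside C)" using assms bounded_inside by (simp add: bounded_Un)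
  then obtain B where "\<forall>z\<in>C \<union> inside C. norm z \<le> B" by (auto simp: bounded_iff)
  moreover have "z \<in> C \<union> inside C \<union> outside C" for z using inside_Un_outside[of C] by blast
  ultimately show ?thesis by (meson UnE not_le)
qed

lemma in_some_face: "z \<notin> D \<Longrightarrow> \<exists>F\<in>components (- D). z \<in> F"
  using Union_components[of "-D"] by blast

lemma connected_in_face:
  assumes "connected A" "A \<inter> D = {}" "A \<noteq> {}" shows "\<exists>F\<in>components (- D). A \<subseteq> F"
proof -
  obtain z where "z \<in> A" using assms by blast
  then show ?thesis using in_some_face[of z D] face_absorbs[OF _ assms(1,2)] assms by blast
qed

lemma face_closure:
  fixes D :: "complex set"
  assumes "closed D" "F \<in> components (- D)" "p \<in> closure F" "p \<notin> D" shows "p \<in> F"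
proof -
  have "frontier F \<subseteq> D" using frontier_of_components_closed_complement assms by blast
  moreover have "open F" using assms by (metis open_Compl open_components)
  ultimately show ?thesis using assms(3,4) by (auto simp: frontier_def interior_open)
qed

lemma open_face:
  fixes D :: "complex set"
  assumes "closed D" "F \<in> components (- D)" shows "open F"
  using assms by (metis open_Compl open_components)

lemma meets_nbhd: "p \<in> closure S \<Longrightarrow> open N \<Longrightarrow> p \<in> N \<Longrightarrow> \<exists>z. z \<in> S \<and> z \<in> N"
  unfolding closure_iff_nhds_not_empty by blast

text \<open>
  The points that can be reached from \<open>R\<close> through at most \<open>k\<close> changes between adjacent faces. Adjacency
  is witnessed by a common point \<open>p\<close> of the closures other than a crossing. The point may lie off the
  diagram, in which case the two faces are equal; this makes the levels increase.
\<close>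

primrec level :: "complex set \<Rightarrow> complex set \<Rightarrow> nat \<Rightarrow> complex set" where
  "level D R 0 = R"
| "level D R (Suc k) = {z. \<exists>F\<in>components (- D). \<exists>G\<in>components (- D).
     z \<in> F \<and> G \<subseteq> level D R k \<and> (\<exists>p. p \<notin> crossings D \<and> p \<in> closure F \<and> p \<in> closure G)}"

declare level.simps(2) [simp del]

lemma level_SucI:
  assumes "F \<in> components (- D)" "G \<in> components (- D)" "G \<subseteq> level D R k"
    "p \<notin> crossings D" "p \<in> closure F" "p \<in> closure G"
  shows "F \<subseteq> level D R (Suc k)"
  unfolding level.simps(2) using assms by blast

lemma level_face:
  assumes "R \<in> components (- D)" "F \<in> components (- D)" "z \<in> F" "z \<in> level D R k"
  shows "F \<subseteq> level D R k"
proof (cases k)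
  case 0
  then show ?thesis using assms components_nonoverlap[of R "-D" F] by auto
next
  case (Suc j)
  then obtain F' G p where *: "F' \<in> components (- D)" "G \<in> components (- D)" "z \<in> F'" "G \<subseteq> level D R j"
    "p \<notin> crossings D" "p \<in> closure F'" "p \<in> closure G"
    using assms(4) unfolding Suc level.simps(2) by blast
  have "F' = F" using * assms components_nonoverlap[of F' "-D" F] by auto
  then show ?thesis using level_SucI[OF *(1,2,4-7)] Suc by simp
qed

lemma level_subset: "R \<in> components (- D) \<Longrightarrow> level D R k \<inter> D = {}"
proof (cases k)
  case 0
  assume "R \<in> components (- D)"
  then show ?thesis using 0 in_components_subset by fastforce
next
  case (Suc j)
  show ?thesis unfolding Suc level.simps(2) using in_components_subset by fastforce
qed

lemma level_mono:
  assumes R: "R \<in> components (- D)" and "j \<le> k" shows "level D R j \<subseteq> level D R k"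
  using \<open>j \<le> k\<close>
proof (induction k rule: dec_induct)
  case (step k)
  have "level D R k \<subseteq> level D R (Suc k)"
  proof
    fix z assume z: "z \<in> level D R k"
    then have "z \<notin> D" using level_subset[OF R] by blast
    then obtain F where F: "F \<in> components (- D)" "z \<in> F" using in_some_face by blast
    have "z \<notin> crossings D" using \<open>z \<notin> D\<close> crossings_subset by blast
    then have "F \<subseteq> level D R (Suc k)"
      using level_SucI[OF F(1) F(1) level_face[OF R F z]] closure_subset F(2) by blast
    then show "z \<in> level D R (Suc k)" using F(2) by blast
  qed
  then show ?case using step by blast
qed simp

lemma unbounded_face:
  fixes D :: "complex set"
  assumes D: "compact D" and R: "R \<in> components (- D)" "\<not> bounded R"
  shows "outside D \<subseteq> R"
proof -
  have bd: "bounded D" using D compact_imp_bounded by blast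
  have "\<not> R \<subseteq> inside D" using R(2) bounded_inside[OF bd] bounded_subset by blast
  moreover have "R \<subseteq> inside D \<union> outside D"
    using in_components_subset[OF R(1)] inside_Un_outside[of D] by blast
  ultimately have "R \<inter> outside D \<noteq> {}" by blast
  moreover have "connected (outside D)" using bd by (simp add: connected_outside)
  ultimately show ?thesis using face_absorbs[OF R(1), of "outside D"] outside_no_overlap[of D] by blast
qed

section \<open>One round of the procedure\<close>

lemma outer_circuitD:
  assumes "outer_circuit c R C"
  shows "compact C" "C \<noteq> {}" "C \<subseteq> frontier R" "R \<subseteq> inside C"
  using assms unfolding outer_circuit_def
  by (auto simp: simple_path_def intro: compact_path_image)

text \<open>
  The outer circuit contributes one step: raise the potential by one outside it and let it vanish
  inside. At a point of the circuit that is not a crossing, one side belongs to the colored region \<open>R\<close> and the other to the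
  next region \<open>S\<close>, so that the jump is exactly one there; a point off the circuit has a whole
  neighbourhood inside or outside.
\<close>

lemma face_potential_beyond_circuit:
  assumes tame: "tame D" and C: "compact C" "C \<subseteq> D" and R: "C \<subseteq> frontier R" "R \<subseteq> inside C" "R \<inter> D = {}"
    and S: "S \<in> components (- D)" "S \<subseteq> outside C" "C \<subseteq> frontier S"
    and pot: "face_potential D \<phi>" and zero: "\<And>z. z \<in> S \<Longrightarrow> \<phi> z = 0"
  shows "face_potential D (\<lambda>z. if z \<in> outside C then \<phi> z + 1 else 0)" (is "face_potential D ?\<psi>")
proof -
  have stay: "A \<subseteq> outside C" if A: "connected A" "A \<inter> D = {}" "z \<in> A" "z \<in> outside C" for A z
  proof
    fix w assume "w \<in> A"
    moreover have "A \<subseteq> - C" using A C by blast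
    ultimately have "connected_component (- C) z w" using A by (auto simp: connected_component_def)
    then show "w \<in> outside C" using outside_same_component A(4) by blast
  qed
  have "?\<psi> z = ?\<psi> w" if A: "connected A" "A \<inter> D = {}" "z \<in> A" "w \<in> A" for A z w
    using face_potential_const[OF pot A] stay[OF A(1,2)] A(3,4) by auto
  moreover have "\<exists>N. open N \<and> p \<in> N \<and> (\<forall>z\<in>N - D. \<forall>w\<in>N - D. \<bar>?\<psi> z - ?\<psi> w\<bar> \<le> 1)"
    if p: "p \<notin> crossings D" for p
  proof -
    have cl: "closed C" using C compact_imp_closed by blast
    consider "p \<in> C" | "p \<in> outside C" | "p \<in> inside C" using inside_Un_outside[of C] by blast
    then show ?thesis
    proof cases
      case 1
      then have "regular D p" using p C tame by (auto simp: tame_def)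
      then obtain V A B where V: "open V" "p \<in> V" "V - D = A \<union> B" and AB: "connected A" "connected B"
        using regular_sides[of D p UNIV] by auto
      have "p \<in> closure R" "p \<in> closure S" using 1 R S by (auto simp: frontier_def)
      then obtain r s where r: "r \<in> R" "r \<in> V" and s: "s \<in> S" "s \<in> V" using V meets_nbhd by metis
      have "S \<inter> D = {}" using in_components_subset S by blast
      then have rs: "r \<in> A \<union> B" "s \<in> A \<union> B" using r s R V by blast+
      \<comment> \<open>The side that contains \<open>r\<close> lies inside the circuit; the side that contains \<open>s\<close> lies in \<open>S\<close>.\<close>
      have sS: "Y \<subseteq> S" if "s \<in> Y" "Y = A \<or> Y = B" for Y
        using face_absorbs[OF S(1), of Y] that s V AB by blast
      have rI: "Y \<inter> outside C = {}" if "r \<in> Y" "Y = A \<or> Y = B" for Y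
      proof (rule ccontr)
        assume "Y \<inter> outside C \<noteq> {}"
        moreover have "connected Y" "Y \<inter> D = {}" using that V AB by blast+
        ultimately have "r \<in> outside C" using stay[of Y] that by blast
        then show False using r R inside_Int_outside[of C] by blast
      qed
      have "?\<psi> z \<in> {0, 1}" if "z \<in> V - D" for z
      proof (cases "z \<in> outside C")
        case True
        have "r \<notin> S" using r R S inside_Int_outside[of C] by blast
        have "z \<in> A \<union> B" using that by (simp only: V(3))
        moreover have "z \<in> S" if Y: "Y = A \<or> Y = B" "Z = A \<or> Z = B" "A \<union> B = Y \<union> Z" "z \<in> Y" for Y Z
        proof -
          have "r \<notin> Y" using rI[OF _ Y(1)] Y(4) True by (meson disjoint_iff)
          then have "r \<in> Z" using rs(1) Y(3) by simp
          then have "s \<notin> Z" using sS[OF _ Y(2)] \<open>r \<notin> S\<close> by (meson subsetD)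
          then have "s \<in> Y" using rs(2) Y(3) by simp
          then show ?thesis using sS[OF _ Y(1)] Y(4) by (meson subsetD)
        qed
        from this[of A B] this[of B A] have "z \<in> A \<Longrightarrow> z \<in> S" "z \<in> B \<Longrightarrow> z \<in> S" by auto
        ultimately have "z \<in> S" by (elim UnE)
        then show ?thesis using zero True by simp
      qed simp
      note vals = this
      have "\<bar>?\<psi> z - ?\<psi> w\<bar> \<le> 1" if "z \<in> V - D" "w \<in> V - D" for z w
        using vals[OF that(1)] vals[OF that(2)] by (elim insertE) simp_all
      then show ?thesis using V by blast
    next
      case 2
      from face_potential_jump[OF pot p] obtain N where
        N: "open N" "p \<in> N" "\<forall>z\<in>N - D. \<forall>w\<in>N - D. \<bar>\<phi> z - \<phi> w\<bar> \<le> 1" by blast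
      show ?thesis
        by (rule exI[of _ "N \<inter> outside C"]) (use N 2 open_outside[OF cl] in auto)
    next
      case 3
      show ?thesis
      proof (intro exI conjI)
        show "open (inside C)" "p \<in> inside C" using 3 open_inside[OF cl] by auto
        have "z \<notin> outside C" if "z \<in> inside C" for z using that inside_Int_outside[of C] by blast
        then show "\<forall>z\<in>inside C - D. \<forall>w\<in>inside C - D. \<bar>?\<psi> z - ?\<psi> w\<bar> \<le> 1" by simp
      qed
    qed
  qed
  ultimately show ?thesis unfolding face_potential_def by blast
qed

text \<open>
  One round of the procedure: \<open>R\<close> is the current region, \<open>R - \<Delta>\<close> what is colored of it, \<open>C\<close> the circuit
  around it and \<open>S\<close> the next region.
\<close>

locale coloring_step = splitting D X U f D' for D X U f D' +
  fixes R S C :: "complex set" and c :: complex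
  assumes R: "R \<in> components (- D)" and X_eq: "X = crossings D \<inter> frontier R"
    and corner: "x \<in> X \<Longrightarrow> quad x 1 \<subseteq> R"
    and C: "outer_circuit c (R - \<Delta>) C"
    and S: "S \<in> components (- D')" "S \<subseteq> outside C" "C \<subseteq> frontier S"
begin

lemma closed_D: "closed D" and closed_D': "closed D'"
  using compact_D compact_D' compact_imp_closed by auto

lemma C_subset_D': "C \<subseteq> D'"
  using frontier_of_components_closed_complement[OF closed_D' S(1)] S(3) by blast

lemma remainder_disjoint: "(R - \<Delta>) \<inter> D' = {}"
  using off_\<Delta> in_components_subset[OF R] by blast

lemma potential_step:
  assumes pot: "face_potential D' \<phi>" "\<And>z. z \<in> S \<Longrightarrow> \<phi> z = 0" and far: "\<And>z. B < norm z \<Longrightarrow> \<phi> z = k"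
  shows "\<exists>\<psi> B. face_potential D \<psi> \<and> (\<forall>z\<in>R. \<psi> z = 0) \<and> (\<forall>z. B < norm z \<longrightarrow> \<psi> z = k + 1)"
proof -
  define \<theta> where "\<theta> z = (if z \<in> outside C then \<phi> z + 1 else 0)" for z
  note CD = outer_circuitD[OF C]
  have "face_potential D' \<theta>"
    unfolding \<theta>_def
    by (rule face_potential_beyond_circuit[OF tame_D' CD(1) C_subset_D' CD(3,4) remainder_disjoint S pot])
  then have pb: "face_potential D (pull_back \<theta>)" by (rule face_potential_pull_back)
  have "R - \<Delta> \<noteq> {}"
  proof
    assume "R - \<Delta> = {}"
    then show False using CD(2,3) frontier_empty by (metis subset_empty)
  qed
  then obtain r where r: "r \<in> R - \<Delta>" by blast
  then have "r \<in> inside C" using CD by blast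
  then have "r \<notin> outside C" using inside_Int_outside[of C] by blast
  then have "pull_back \<theta> r = 0" using pull_back_off_\<Delta> r by (simp add: \<theta>_def)
  moreover have "connected R" "R \<inter> D = {}"
    using R in_components_connected in_components_subset by blast+
  ultimately have "\<forall>z\<in>R. pull_back \<theta> z = 0"
    using face_potential_const[OF pb] r by (metis DiffD1)
  moreover obtain B1 where B1: "\<forall>z. B1 < norm z \<longrightarrow> z \<in> outside C"
    using far_points_outside compact_imp_bounded CD(1) by blast
  obtain B2 where B2: "\<forall>z\<in>\<Delta>. norm z \<le> B2"
    using compact_imp_bounded[OF compact_\<Delta>] by (auto simp: bounded_iff)
  have "pull_back \<theta> z = k + 1" if "max B (max B1 B2) < norm z" for z
  proof -
    have "z \<notin> \<Delta>" using B2 that by (meson max_less_iff_conj not_le)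
    then show ?thesis using pull_back_off_\<Delta> B1 far that by (simp add: \<theta>_def)
  qed
  ultimately show ?thesis using pb by blast
qed

text \<open>
  Quadrants at a split crossing that share a half-axis lie in adjacent faces. Counted from the corner
  of \<open>R\<close>, the two merged quadrants are therefore one step away, and every quadrant at most two.
\<close>

lemma level_across_half_axis:
  assumes x: "x \<in> X" "u \<in> units" and "F \<in> components (- D)" "F \<inter> quad x u \<noteq> {}"
    and "G \<in> components (- D)" "G \<inter> quad x (\<i> * u) \<noteq> {}"
  shows "G \<subseteq> level D R k \<Longrightarrow> F \<subseteq> level D R (Suc k)" "F \<subseteq> level D R k \<Longrightarrow> G \<subseteq> level D R (Suc k)"
proof -
  have "quad x u \<subseteq> F" "quad x (\<i> * u) \<subseteq> G"
    using assms face_absorbs connected_quad quad_disjoint_D units_invariant(2) by blast+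
  moreover obtain p where "p \<notin> crossings D" "p \<in> closure (quad x u - \<Delta>)" "p \<in> closure (quad x (\<i> * u) - \<Delta>)"
    using half_axis_point[OF x] by blast
  ultimately have "p \<notin> crossings D" "p \<in> closure F" "p \<in> closure G"
    using closure_mono[of "quad x u - \<Delta>" F] closure_mono[of "quad x (\<i> * u) - \<Delta>" G] by blast+
  then show "G \<subseteq> level D R k \<Longrightarrow> F \<subseteq> level D R (Suc k)" "F \<subseteq> level D R k \<Longrightarrow> G \<subseteq> level D R (Suc k)"
    using level_SucI[OF assms(3,5)] level_SucI[OF assms(5,3)] by blast+
qed

lemma region_meets_corner: "x \<in> X \<Longrightarrow> R \<inter> quad x 1 \<noteq> {}"
  using corner quad_off_\<Delta>_nonempty[of x 1] by (auto simp: units_def)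

lemma level_merged:
  assumes "x \<in> X" "u \<in> {\<i>, -\<i>}" "F \<in> components (- D)" "F \<inter> quad x u \<noteq> {}"
  shows "F \<subseteq> level D R 1"
proof -
  have "R \<subseteq> level D R 0" by simp
  then show ?thesis
    using level_across_half_axis(2)[OF assms(1) _ R region_meets_corner[OF assms(1)] assms(3), of 0]
      level_across_half_axis(1)[OF assms(1) _ assms(3) _ R, of "-\<i>" 0] region_meets_corner[OF assms(1)] assms
    by (auto simp: units_def)
qed

lemma level_any_corner:
  assumes x: "x \<in> X" "u \<in> units" and F: "F \<in> components (- D)" "F \<inter> quad x u \<noteq> {}"
  shows "F \<subseteq> level D R 2"
proof -
  consider "u = 1" | "u \<in> {\<i>, -\<i>}" | "u = -1" using x by (auto simp: units_def)
  then show ?thesis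
  proof cases
    case 1
    then have "F \<inter> R \<noteq> {}" using F corner[OF x(1)] by blast
    then have "F = R" using components_nonoverlap[OF F(1) R] by blast
    then show ?thesis using level_mono[OF R, of 0 2] by simp
  next
    case 2
    then show ?thesis using level_merged[OF x(1) _ F] level_mono[OF R, of 1 2] by auto
  next
    case 3
    have iu: "\<i> \<in> units" "\<i> * \<i> = u" using 3 by (auto simp: units_def)
    have ne: "quad x \<i> \<noteq> {}" using quad_off_\<Delta>_nonempty[OF x(1) iu(1)] by blast
    then obtain G where G: "G \<in> components (- D)" "quad x \<i> \<subseteq> G"
      using connected_in_face[OF connected_quad quad_disjoint_D] x(1) iu(1) by blast
    then have "G \<inter> quad x \<i> \<noteq> {}" using ne by blast
    then show ?thesis
      using level_across_half_axis(2)[OF x(1) iu(1) G(1) _ F(1), of 1] level_merged[OF x(1) _ G(1), of \<i>]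
        F(2) iu(2) by (simp add: numeral_2_eq_2)
  qed
qed

text \<open>
  A face of the split diagram is composed of faces of \<open>D\<close> that are joined through diamonds. Every face
  that takes part contains a merged quadrant, hence is adjacent to \<open>R\<close>. If none does, the face of
  \<open>D'\<close> cannot leave the face of \<open>D\<close> in which it starts: the only part of the rim of a diamond that is
  not in \<open>D'\<close> consists of the sides in the merged quadrants.
\<close>

lemma face_unmerged:
  assumes G: "G \<in> components (- D')" and F: "F \<in> components (- D)" and z: "z \<in> G" "z \<in> F" "z \<notin> \<Delta>"
    and un: "\<And>x u. x \<in> X \<Longrightarrow> u \<in> {\<i>, -\<i>} \<Longrightarrow> F \<inter> quad x u = {}"
  shows "G \<subseteq> F - \<Delta>"
proof (rule ccontr)
  assume "\<not> G \<subseteq> F - \<Delta>"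
  then have "G \<inter> frontier (F - \<Delta>) \<noteq> {}"
    using connected_Int_frontier[of G "F - \<Delta>"] z in_components_connected[OF G] by blast
  then obtain w where w: "w \<in> G" "w \<in> frontier (F - \<Delta>)" by blast
  have "open (F - \<Delta>)" using open_face[OF closed_D F] closed_\<Delta> by blast
  then have wc: "w \<in> closure (F - \<Delta>)" "w \<notin> F - \<Delta>" using w by (auto simp: frontier_def interior_open)
  have wD': "w \<notin> D'" using w(1) in_components_subset[OF G] by blast
  show False
  proof (cases "w \<in> \<Delta>")
    case False
    then have "w \<notin> D" using wD' off_\<Delta> by blast
    moreover have "w \<in> closure F" using wc(1) closure_mono[of "F - \<Delta>" F] by blast
    ultimately show False using face_closure[OF closed_D F] wc(2) False by blast
  next
    case True
    then obtain x where x: "x \<in> X" "w \<in> U x" "f x w \<in> diamond" by (auto simp: \<Delta>_def)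
    \<comment> \<open>A point that is approached from outside the diamonds lies on the rim of a diamond.\<close>
    let ?I = "{z \<in> U x. f x z \<in> {z. \<bar>Re z\<bar> + \<bar>Im z\<bar> < 1/2}}"
    have "open ?I" by (rule open_preimage[OF x(1)]) (intro open_Collect_less continuous_intros)
    moreover have "?I \<subseteq> \<Delta>" using x(1) by (auto simp: \<Delta>_def diamond_def)
    ultimately have "w \<notin> ?I" using meets_nbhd[OF wc(1), of ?I] by blast
    then have "\<bar>Re (f x w)\<bar> + \<bar>Im (f x w)\<bar> = 1/2" using x by (simp add: diamond_def)
    moreover have "f x w \<notin> split_cross" using D'_in_disc[OF x(1,2)] wD' by blast
    ultimately have "Re (f x w) * Im (f x w) < 0" by (auto simp: split_cross_def)
    then have "w \<in> quad x \<i> \<or> w \<in> quad x (-\<i>)"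
      using x(2) by (auto simp: quad_def mult_less_0_iff)
    then obtain u where u: "u \<in> {\<i>, -\<i>}" "w \<in> quad x u" by blast
    then obtain y where "y \<in> F - \<Delta>" "y \<in> quad x u"
      using meets_nbhd[OF wc(1) open_quad[OF x(1)]] by blast
    then show False using un[OF x(1) u(1)] by blast
  qed
qed

text \<open>
  All crossings of \<open>D\<close> on the boundary of \<open>R\<close> have been split, so none is left on the circuit.
\<close>

lemma circuit_not_crossing:
  assumes "p \<in> C" shows "p \<notin> crossings D"
proof
  assume p: "p \<in> crossings D"
  have "p \<in> closure (R - \<Delta>)" using assms outer_circuitD(3)[OF C] by (auto simp: frontier_def)
  then have "p \<in> closure R" using closure_mono[of "R - \<Delta>" R] by blast
  moreover have "p \<notin> R" using p crossings_subset in_components_subset[OF R] by blast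
  ultimately have "p \<in> X"
    using p open_face[OF closed_D R] X_eq by (simp add: frontier_def interior_open)
  then have "p \<in> U p" "f p p = 0" using chart by (auto simp: chart_def)
  then have "p \<notin> D'" using D'_in_disc[OF \<open>p \<in> X\<close>, of p] by (simp add: split_cross_graph)
  then show False using assms C_subset_D' by blast
qed

text \<open>
  A chain of faces of \<open>D'\<close> from \<open>S\<close> becomes a chain of faces of \<open>D\<close> from \<open>R\<close> that is longer by one.
  Whenever the chain enters a face that takes part in a merging, it can be restarted, since all faces
  of \<open>D\<close> in it are one step away from \<open>R\<close>. The other faces of \<open>D'\<close> lie in single faces of \<open>D\<close>, where the
  step is the same in both diagrams unless it takes place at a diamond; in that case the new face has
  a corner at a split crossing and is at most two steps away from \<open>R\<close>.
\<close>

lemma level_step: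
  assumes "z \<in> level D' S k" "z \<notin> \<Delta>"
  shows "z \<in> level D R (Suc k)"
  using assms
proof (induction k arbitrary: z)
  case (0 z)
  then have zS: "z \<in> S" by simp
  then have "z \<notin> D" using in_components_subset[OF S(1)] off_\<Delta> 0 by blast
  then obtain F where F: "F \<in> components (- D)" "z \<in> F" using in_some_face by blast
  have "F \<subseteq> level D R (Suc 0)"
  proof (cases "\<exists>x\<in>X. \<exists>u\<in>{\<i>, -\<i>}. F \<inter> quad x u \<noteq> {}")
    case True
    then show ?thesis using level_merged F by (metis One_nat_def)
  next
    case False
    then have "S \<subseteq> F - \<Delta>" using face_unmerged[OF S(1) F(1) zS F(2) 0(2)] by blast
    then have cl: "closure S \<subseteq> closure F" by (intro closure_mono) blast
    obtain p where p: "p \<in> C" using outer_circuitD(2)[OF C] by blast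
    have "p \<in> closure S" "p \<in> closure (R - \<Delta>)"
      using p S(3) outer_circuitD(3)[OF C] by (auto simp: frontier_def)
    then have "p \<in> closure F" "p \<in> closure R" using cl closure_mono[of "R - \<Delta>" R] by blast+
    then show ?thesis using level_SucI[OF F(1) R, of R 0 p] circuit_not_crossing[OF p] by simp
  qed
  then show ?case using F by blast
next
  case (Suc k z)
  obtain G' G p where G': "G' \<in> components (- D')" "z \<in> G'" and G: "G \<in> components (- D')" "G \<subseteq> level D' S k"
    and p: "p \<notin> crossings D'" "p \<in> closure G'" "p \<in> closure G"
    using Suc.prems(1) unfolding level.simps(2) by blast
  have "z \<notin> D" using in_components_subset[OF G'(1)] G'(2) off_\<Delta> Suc.prems(2) by blast
  then obtain F where F: "F \<in> components (- D)" "z \<in> F" using in_some_face by blast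
  have "F \<subseteq> level D R (Suc (Suc k))"
  proof (cases "\<exists>x\<in>X. \<exists>u\<in>{\<i>, -\<i>}. F \<inter> quad x u \<noteq> {}")
    case True
    then have "F \<subseteq> level D R 1" using level_merged F by blast
    then show ?thesis using level_mono[OF R, of 1 "Suc (Suc k)"] by auto
  next
    case False
    then have G'F: "G' \<subseteq> F - \<Delta>" using face_unmerged[OF G'(1) F(1) G'(2) F(2) Suc.prems(2)] by blast
    then have pF: "p \<in> closure F" using p(2) closure_mono[of G' F] by blast
    show ?thesis
    proof (cases "p \<in> D'")
      case False
      then have "p \<in> G'" "p \<in> G" using face_closure[OF closed_D'] G' G p by blast+
      then have "G' = G" using components_nonoverlap[OF G'(1) G(1)] by blast
      then have "z \<in> level D R (Suc k)" using Suc.IH G(2) G'(2) Suc.prems(2) by blast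
      then show ?thesis using level_face[OF R F] level_mono[OF R, of "Suc k" "Suc (Suc k)"] by auto
    next
      case pD': True
      show ?thesis
      proof (cases "p \<in> \<Delta>")
        case True
        then obtain x where x: "x \<in> X" "p \<in> U x" by (auto simp: \<Delta>_def)
        obtain y where y: "y \<in> G'" "y \<in> U x" using meets_nbhd[OF p(2) open_disc[OF x(1)] x(2)] by blast
        then have "y \<in> F" "y \<notin> D" using G'F in_components_subset[OF F(1)] by blast+
        then obtain u where "u \<in> units" "y \<in> quad x u" using in_quad[OF x(1) y(2)] by blast
        then have "F \<subseteq> level D R 2" using level_any_corner[OF x(1) _ F(1)] \<open>y \<in> F\<close> by blast
        then show ?thesis using level_mono[OF R, of 2 "Suc (Suc k)"] by auto
      next
        case p\<Delta>: False
        then have pD: "p \<in> D" "p \<notin> crossings D" using pD' p off_\<Delta> crossings_off_\<Delta> by blast+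
        then have "regular D p" using tame by (auto simp: tame_def)
        then obtain V A B where V: "open V" "p \<in> V" "V \<subseteq> - \<Delta>" "V - D = A \<union> B" and AB: "connected A" "connected B"
          using regular_sides[of D p "- \<Delta>"] closed_\<Delta> p\<Delta> by (metis ComplI open_Compl)
        have "G \<inter> V \<subseteq> (A \<inter> G) \<union> (B \<inter> G)"
          using V off_\<Delta> in_components_subset[OF G(1)] by blast
        moreover have "p \<in> closure (G \<inter> V)"
          using open_Int_closure_subset[OF V(1), of G] p(3) V(2) by (metis Int_commute IntI subsetD)
        ultimately have "p \<in> closure (A \<inter> G) \<union> closure (B \<inter> G)"
          by (metis closure_Un closure_mono subsetD)
        then obtain Y where Y: "Y = A \<or> Y = B" "p \<in> closure (Y \<inter> G)" by blast
        then obtain y where y: "y \<in> Y" "y \<in> G" by (metis IntE closure_empty empty_iff ex_in_conv)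
        have "connected Y" "Y \<inter> D = {}" "y \<notin> \<Delta>" using Y AB V y by blast+
        then obtain F1 where F1: "F1 \<in> components (- D)" "Y \<subseteq> F1" using connected_in_face y by blast
        have "y \<in> level D R (Suc k)" using Suc.IH y G(2) \<open>y \<notin> \<Delta>\<close> by blast
        then have "F1 \<subseteq> level D R (Suc k)" using level_face[OF R F1(1)] y F1(2) by blast
        moreover have "p \<in> closure F1" using Y(2) closure_mono[of "Y \<inter> G" F1] F1(2) by blast
        ultimately show ?thesis using level_SucI[OF F(1) F1(1) _ pD(2) pF] by blast
      qed
    qed
  qed
  then show ?case using F by blast
qed

end

section \<open>The whole procedure\<close>

lemma coloring_step_of_procedure:
  assumes tame: "tame D" and R: "R \<in> components (- D)"
    and sb: "split_boundary c D R D' R'" and nr: "next_region c D' R' S"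
  shows "\<exists>X U f C. coloring_step D X U f D' R S C c"
proof -
  define X where "X = crossings D \<inter> frontier R"
  obtain U f where ch: "\<forall>x\<in>X. chart x (U x) (f x) \<and> c \<notin> U x \<and>
                looks_like D (U x) (f x) (real_axis \<union> imag_axis) \<and>
                {z \<in> U x. 0 < Re (f x z) \<and> 0 < Im (f x z)} \<subseteq> R"
    and dj: "disjoint_family_on U X"
    and D': "D' = (D - (\<Union>x\<in>X. U x)) \<union> (\<Union>x\<in>X. {z \<in> U x. f x z \<in> split_cross})"
    and R': "R' = R - (\<Union>x\<in>X. {z \<in> U x. f x z \<in> diamond})"
    using sb unfolding split_boundary_def Let_def X_def by blast
  have sp: "splitting D X U f D'"
  proof (unfold_locales)
    show "tame D" by fact
    show "X \<subseteq> crossings D" by (auto simp: X_def)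
    show "disjoint_family_on U X" by fact
    show "D' = (D - (\<Union>x\<in>X. U x)) \<union> (\<Union>x\<in>X. {z \<in> U x. f x z \<in> split_cross})" by fact
    show "chart x (U x) (f x)" "looks_like D (U x) (f x) axes" if "x \<in> X" for x using ch that by blast+
  qed
  have \<Delta>: "splitting.\<Delta> X U f = (\<Union>x\<in>X. {z \<in> U x. f x z \<in> diamond})"
    by (rule splitting.\<Delta>_def[OF sp])
  obtain C where C: "outer_circuit c R' C" "S \<in> components (- D')" "S \<subseteq> outside C" "C \<subseteq> frontier S"
    using nr unfolding next_region_def by blast
  have "coloring_step D X U f D' R S C c"
  proof (rule coloring_step.intro[OF sp], unfold_locales)
    show "splitting.quad U f x 1 \<subseteq> R" if "x \<in> X" for x
    proof -
      have "splitting.quad U f x 1 = {z \<in> U x. 0 < Re (f x z) \<and> 0 < Im (f x z)}"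
        by (simp add: splitting.quad_def[OF sp])
      then show ?thesis using ch that by blast
    qed
    show "outer_circuit c (R - splitting.\<Delta> X U f) C" using C(1) R' \<Delta> by simp
  qed (use R C X_def in auto)
  then show ?thesis by blast
qed

text \<open>
  Both inductions follow the run of the procedure backwards, from the final diagram, where the region
  is unbounded and nothing remains to be crossed.
\<close>

lemma procedure_potential:
  assumes "color_from c D R E Rs" "tame D" "R \<in> components (- D)"
  shows "\<exists>\<phi> B. face_potential D \<phi> \<and> (\<forall>z\<in>R. \<phi> z = 0) \<and> (\<forall>z. B < norm z \<longrightarrow> \<phi> z = int (length Rs))"
  using assms
proof (induction rule: color_from.induct)
  case (stop R D)
  have "face_potential D (\<lambda>_. 0)" unfolding face_potential_def by (auto intro: exI[of _ UNIV])
  then show ?case by auto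
next
  case (color R D D' R' S E Rs)
  obtain X U f C where "coloring_step D X U f D' R S C c"
    using coloring_step_of_procedure[OF color.prems color.hyps(2,3)] by blast
  then interpret coloring_step D X U f D' R S C c .
  obtain \<phi> B where \<phi>: "face_potential D' \<phi>" "\<forall>z\<in>S. \<phi> z = 0" "\<forall>z. B < norm z \<longrightarrow> \<phi> z = int (length Rs)"
    using color.IH[OF tame_D' S(1)] by blast
  have "int (length (R' # Rs)) = int (length Rs) + 1" by simp
  then show ?case using potential_step[OF \<phi>(1), of B "int (length Rs)"] \<phi>(2,3) by metis
qed

lemma procedure_level:
  assumes "color_from c D R E Rs" "tame D" "R \<in> components (- D)"
  shows "\<exists>B. \<forall>z. B < norm z \<longrightarrow> z \<in> level D R (length Rs)"
  using assms
proof (induction rule: color_from.induct)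
  case (stop R D)
  then have "outside D \<subseteq> R" "bounded D"
    using unbounded_face compact_imp_bounded by (auto simp: tame_def)
  then show ?case using far_points_outside[of D] by auto
next
  case (color R D D' R' S E Rs)
  obtain X U f C where "coloring_step D X U f D' R S C c"
    using coloring_step_of_procedure[OF color.prems color.hyps(2,3)] by blast
  then interpret coloring_step D X U f D' R S C c .
  obtain B where B: "\<forall>z. B < norm z \<longrightarrow> z \<in> level D' S (length Rs)"
    using color.IH[OF tame_D' S(1)] by blast
  obtain B' where B': "\<forall>z\<in>\<Delta>. norm z \<le> B'"
    using compact_imp_bounded[OF compact_\<Delta>] by (auto simp: bounded_iff)
  have "z \<in> level D R (Suc (length Rs))" if "max B B' < norm z" for z
  proof (rule level_step)
    show "z \<in> level D' S (length Rs)" using B that by simp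
    show "z \<notin> \<Delta>" using B' that by (meson max_less_iff_conj not_le)
  qed
  then have "\<exists>B. \<forall>z. B < norm z \<longrightarrow> z \<in> level D R (Suc (length Rs))" by blast
  then show ?case by simp
qed

section \<open>Meridians from chains of faces\<close>

text \<open>
  \<open>P\<close> is only required to lie on the second axis near \<open>p\<close>, not to fill it. This passes to subsets, and in
  particular to an arc extracted from a path; that an arc does fill the axis near an interior point is
  shown afterwards.
\<close>

definition crosses_in :: "complex set \<Rightarrow> complex set \<Rightarrow> complex \<Rightarrow> bool" where
  "crosses_in D P p \<longleftrightarrow>
     (\<exists>U f. chart p U f \<and> looks_like D U f real_axis \<and> (\<forall>z\<in>P \<inter> U. f z \<in> imag_axis))"

lemma crosses_in_local:
  assumes "crosses_in D P p" and N: "open N" "p \<in> N" and sub: "P' \<inter> N \<subseteq> P"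
  shows "crosses_in D P' p"
proof -
  obtain U f where ch: "chart p U f" and L: "looks_like D U f real_axis" and P: "\<forall>z\<in>P \<inter> U. f z \<in> imag_axis"
    using assms(1) by (auto simp: crosses_in_def)
  obtain r where r: "0 < r" "{z \<in> U. norm (f z) < r} \<subseteq> N"
    and c: "chart p {z \<in> U. norm (f z) < r} (\<lambda>z. f z / of_real r)"
    using chart_shrink[OF ch N(1,2)] by blast
  have "looks_like D {z \<in> U. norm (f z) < r} (\<lambda>z. f z / of_real r) real_axis"
    using L cone_axes(1) r unfolding looks_like_iff[OF c] looks_like_iff[OF ch] cone_def by blast
  moreover have "f z / of_real r \<in> imag_axis" if "z \<in> P' \<inter> {z \<in> U. norm (f z) < r}" for z
  proof -
    have "z \<in> P \<inter> U" using that r(2) sub by blast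
    then have "f z \<in> imag_axis" using P by blast
    then show ?thesis using cone_axes(2) r(1) unfolding cone_def by blast
  qed
  ultimately show ?thesis unfolding crosses_in_def using c by blast
qed

definition crossing_path :: "complex set \<Rightarrow> complex \<Rightarrow> complex \<Rightarrow> nat \<Rightarrow> (real \<Rightarrow> complex) \<Rightarrow> bool" where
  "crossing_path D a b k g \<longleftrightarrow> path g \<and> pathstart g = a \<and> pathfinish g = b \<and>
     finite (path_image g \<inter> D) \<and> card (path_image g \<inter> D) \<le> k \<and>
     (\<forall>p\<in>path_image g \<inter> D. crosses_in D (path_image g) p)"

lemma path_in_face:
  fixes D :: "complex set"
  assumes "closed D" "F \<in> components (- D)" "w \<in> F" "z \<in> F"
  obtains h where "path h" "path_image h \<subseteq> F" "pathstart h = w" "pathfinish h = z"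
proof -
  have "path_connected F"
    using assms(1,2) connected_open_path_connected in_components_connected open_face by blast
  then show thesis using that assms(3,4) unfolding path_connected_def by blast
qed

lemma crossing_path_within_face:
  assumes D: "closed D" and g: "crossing_path D a w k g" and F: "F \<in> components (- D)" "w \<in> F" "z \<in> F"
  obtains h where "crossing_path D a z k h" "path_image h \<inter> D = path_image g \<inter> D"
proof -
  obtain q where q: "path q" "path_image q \<subseteq> F" "pathstart q = w" "pathfinish q = z"
    using path_in_face[OF D F] by blast
  have qD: "path_image q \<inter> D = {}" using q(2) in_components_subset[OF F(1)] by blast
  have gg: "path g" "pathstart g = a" "pathfinish g = w" using g by (auto simp: crossing_path_def)
  have im: "path_image (g +++ q) = path_image g \<union> path_image q"
    using gg q by (simp add: path_image_join)
  have imD: "path_image (g +++ q) \<inter> D = path_image g \<inter> D" using qD by (auto simp: im)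
  have "crosses_in D (path_image (g +++ q)) p" if p: "p \<in> path_image g \<inter> D" for p
  proof (rule crosses_in_local)
    show "crosses_in D (path_image g) p" using g p by (auto simp: crossing_path_def)
    show "open (- path_image q)" using closed_path_image[OF q(1)] by blast
    show "p \<in> - path_image q" using p qD by blast
  qed (auto simp: im)
  then have "crossing_path D a z k (g +++ q)"
    using g gg q imD by (auto simp: crossing_path_def)
  then show thesis using that imD by blast
qed

lemma crosses_in_vertical:
  assumes ch: "chart p U f" and L: "looks_like D U f real_axis"
    and q: "q \<in> U" "f q = of_real t" "\<bar>t\<bar> < 1/2" and P: "\<And>z. z \<in> P \<inter> U \<Longrightarrow> Re (f z) = t"
  shows "crosses_in D P q"
proof -
  obtain g where g: "homeomorphism U (ball 0 1) f g" and U: "open U" using ch by (auto simp: chart_def)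
  let ?F = "\<lambda>z. f z - of_real t"
  have "continuous_on U ?F" "inj_on ?F U"
    using g by (auto simp: homeomorphism_def inj_on_def intro!: continuous_intros)
  then obtain G where G: "homeomorphism U (?F ` U) ?F G"
    using invariance_of_domain_homeomorphism[OF U, of ?F] by auto
  have "ball 0 (1/2) \<subseteq> ?F ` U"
  proof
    fix w :: complex assume "w \<in> ball 0 (1/2)"
    then have "norm (w + of_real t) < 1" using q(3) norm_triangle_ineq[of w "of_real t"] by simp
    then have "w + of_real t \<in> f ` U" using g by (simp add: homeomorphism_def)
    then obtain z where "z \<in> U" "f z = w + of_real t" by force
    then show "w \<in> ?F ` U" by (intro image_eqI[of _ _ z]) simp_all
  qed
  from chart_of_homeomorphism[OF G U q(1) _ _ this]
  have c: "chart q {z \<in> U. norm (f z - of_real t) < 1/2} (\<lambda>z. (f z - of_real t) / of_real (1/2))"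
    using q(2) by simp
  have Dz: "z \<in> D \<longleftrightarrow> Im (f z) = 0" if "z \<in> U" for z
    using L that unfolding looks_like_iff[OF ch] by (simp add: real_axis_def)
  have "looks_like D {z \<in> U. norm (f z - of_real t) < 1/2} (\<lambda>z. (f z - of_real t) / of_real (1/2)) real_axis"
    unfolding looks_like_iff[OF c] using Dz by (simp add: real_axis_def)
  moreover have "\<forall>z\<in>P \<inter> {z \<in> U. norm (f z - of_real t) < 1/2}. (f z - of_real t) / of_real (1/2) \<in> imag_axis"
    using P by (simp add: imag_axis_def)
  ultimately show ?thesis unfolding crosses_in_def using c by blast
qed

text \<open>
  Two different faces that touch at a regular point lie on its two sides. They then touch along a
  whole piece of edge, so that the segment from one to the other can avoid finitely many points where
  a path has crossed already.
\<close>

lemma crossing_segment: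
  assumes reg: "regular D p" and F: "F \<in> components (- D)" and G: "G \<in> components (- D)" "F \<noteq> G"
    and p: "p \<in> closure F" "p \<in> closure G" and T: "finite T"
  obtains q \<sigma> where "path \<sigma>" "pathstart \<sigma> \<in> G" "pathfinish \<sigma> \<in> F" "path_image \<sigma> \<inter> D = {q}" "q \<notin> T"
    "crosses_in D (path_image \<sigma>) q"
proof -
  obtain U f where ch: "chart p U f" and L: "looks_like D U f real_axis"
    using reg by (auto simp: regular_def)
  obtain g where g: "homeomorphism U (ball 0 1) f g" and U: "open U" "p \<in> U" using ch by (auto simp: chart_def)
  have gU: "g w \<in> U" "f (g w) = w" if "norm w < 1" for w using g that by (auto simp: homeomorphism_def)
  have Dz: "z \<in> D \<longleftrightarrow> Im (f z) = 0" if "z \<in> U" for z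
    using L that unfolding looks_like_iff[OF ch] by (simp add: real_axis_def)
  have cg: "continuous_on (ball 0 1) g" using g by (simp add: homeomorphism_def)
  \<comment> \<open>A face that meets one side of the line in the disc contains all of that side.\<close>
  have half: "g w \<in> H" if H: "H \<in> components (- D)" "z \<in> H" "z \<in> U" and w: "norm w < 1" "0 < Im (f z) * Im w" for H z w
  proof -
    let ?s = "closed_segment (f z) w"
    have fz: "norm (f z) < 1" using g H(3) by (auto simp: homeomorphism_def)
    have seg: "?s \<subseteq> ball 0 1" using fz w(1) by (intro closed_segment_subset) auto
    have "0 < Im (f z) * Im v" if "v \<in> ?s" for v
    proof -
      have "convex {v. 0 < Im (f z) * Im v}"
      proof -
        have "{v. 0 < Im (f z) * Im v} = {v. inner (Complex 0 (Im (f z))) v > 0}" by (auto simp: inner_complex_def)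
        then show ?thesis by (metis convex_halfspace_gt)
      qed
      moreover have "0 < Im (f z) * Im (f z)" using w(2) by (metis mult_zero_left not_real_square_gt_zero order_less_irrefl)
      ultimately have "?s \<subseteq> {v. 0 < Im (f z) * Im v}" using w(2) by (intro closed_segment_subset) auto
      then show ?thesis using that by blast
    qed
    then have "g ` ?s \<inter> D = {}" using seg gU Dz by fastforce
    moreover have "connected (g ` ?s)"
      using cg seg by (meson connected_continuous_image connected_segment continuous_on_subset)
    moreover have "z \<in> g ` ?s"
    proof -
      have "g (f z) = z" using g H(3) by (simp add: homeomorphism_def)
      then show ?thesis by (metis ends_in_segment(1) image_eqI)
    qed
    ultimately have "g ` ?s \<subseteq> H" using face_absorbs[OF H(1), of "g ` ?s"] H(2) by blast
    then show ?thesis by (meson ends_in_segment(2) image_subset_iff)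
  qed
  obtain z where z: "z \<in> F" "z \<in> U" using meets_nbhd[OF p(1) U] by blast
  obtain y where y: "y \<in> G" "y \<in> U" using meets_nbhd[OF p(2) U] by blast
  have "z \<notin> D" "y \<notin> D" using z y in_components_subset F G by blast+
  then have nz: "Im (f z) \<noteq> 0" "Im (f y) \<noteq> 0" using Dz z y by auto
  \<comment> \<open>The sign of \<open>s\<close> tells on which side \<open>F\<close> lies.\<close>
  define s where "s = sgn (Im (f z)) / 2"
  have s: "s \<noteq> 0" "\<bar>s\<bar> = 1/2" "0 < Im (f z) * s" using nz by (auto simp: s_def abs_sgn_eq sgn_if)
  have opp: "0 < Im (f y) * (- s)"
  proof (rule ccontr)
    assume "\<not> ?thesis"
    then have "0 < Im (f y) * s" using nz(2) s(1) by (simp add: not_less order_less_le)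
    moreover have "norm (Complex 0 s) < 1" using s cmod_le[of "Complex 0 s"] by simp
    ultimately have "g (Complex 0 s) \<in> F" "g (Complex 0 s) \<in> G"
      using half[OF F z, of "Complex 0 s"] half[OF G(1) y, of "Complex 0 s"] s by auto
    then show False using components_nonoverlap[OF F G(1)] G(2) by blast
  qed
  have "infinite ((\<lambda>t. g (of_real t)) ` {0<..<1/2})"
  proof
    assume "finite ((\<lambda>t. g (of_real t)) ` {0<..<1/2})"
    moreover have "inj_on (\<lambda>t. g (of_real t)) {0<..<1/2}"
    proof (rule inj_onI)
      fix a b :: real assume ab: "a \<in> {0<..<1/2}" "b \<in> {0<..<1/2}" "g (of_real a) = g (of_real b)"
      have "norm (complex_of_real a) < 1" "norm (complex_of_real b) < 1" using ab(1,2) by auto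
      then have "complex_of_real a = of_real b" using gU(2) ab(3) by metis
      then show "a = b" by (simp only: of_real_eq_iff)
    qed
    ultimately have "finite {0<..<1/2::real}" by (rule finite_imageD)
    then show False by (simp add: infinite_Ioo)
  qed
  then have "(\<lambda>t. g (of_real t)) ` {0<..<1/2} - T \<noteq> {}"
    using Diff_infinite_finite[OF T] by (metis finite.emptyI)
  then obtain t where t: "0 < t" "t < 1/2" "g (of_real t) \<notin> T" by force
  define \<sigma> where "\<sigma> = g \<circ> linepath (Complex t (- s)) (Complex t s)"
  have seg: "norm v < 1" "Re v = t" if "v \<in> closed_segment (Complex t (- s)) (Complex t s)" for v
  proof -
    let ?B = "{v. Re v \<le> t} \<inter> {v. Re v \<ge> t} \<inter> {v. Im v \<le> 1/2} \<inter> {v. Im v \<ge> -(1/2)}"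
    have "convex ?B"
      by (intro convex_Int convex_halfspace_Im_le convex_halfspace_Im_ge convex_halfspace_Re_le convex_halfspace_Re_ge)
    moreover have "Complex t (- s) \<in> ?B" "Complex t s \<in> ?B" using s(2) by auto
    ultimately have "closed_segment (Complex t (- s)) (Complex t s) \<subseteq> ?B" by (intro closed_segment_subset)
    then have "v \<in> ?B" using that by (rule subsetD)
    then show "Re v = t" "norm v < 1" using cmod_le[of v] t by auto
  qed
  have im: "path_image \<sigma> = g ` closed_segment (Complex t (- s)) (Complex t s)"
    unfolding \<sigma>_def by (simp add: path_image_compose)
  have inU: "\<exists>v. norm v < 1 \<and> Re v = t \<and> z \<in> U \<and> f z = v" if "z \<in> path_image \<sigma>" for z
    using that seg gU unfolding im by blast
  have q: "norm (complex_of_real t) < 1" using t by simp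
  have "g (of_real t) \<in> path_image \<sigma>"
  proof -
    have "of_real t = midpoint (Complex t (- s)) (Complex t s)" by (simp add: midpoint_def complex_eq_iff)
    then show ?thesis unfolding im by (metis image_eqI midpoint_in_closed_segment)
  qed
  moreover have "g (of_real t) \<in> D" using Dz[of "g (of_real t)"] gU[OF q] by simp
  moreover have "z = g (of_real t)" if "z \<in> path_image \<sigma>" "z \<in> D" for z
  proof -
    have "z \<in> U" "f z = of_real t" using inU[OF that(1)] Dz that(2) by (auto simp: complex_eq_iff)
    then show ?thesis using g by (metis homeomorphism_apply1)
  qed
  ultimately have imD: "path_image \<sigma> \<inter> D = {g (of_real t)}" by blast
  have "path \<sigma>"
    unfolding \<sigma>_def
    by (rule path_continuous_image[OF path_linepath])
       (use seg in \<open>auto intro: continuous_on_subset[OF cg]\<close>)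
  moreover have "pathstart \<sigma> \<in> G"
    using half[OF G(1) y, of "Complex t (- s)"] opp seg(1)[of "Complex t (- s)"]
    by (simp add: \<sigma>_def pathstart_compose)
  moreover have "pathfinish \<sigma> \<in> F"
    using half[OF F z, of "Complex t s"] s(3) seg(1)[of "Complex t s"]
    by (simp add: \<sigma>_def pathfinish_compose)
  moreover have "crosses_in D (path_image \<sigma>) (g (of_real t))"
    by (rule crosses_in_vertical[OF ch L, of _ t]) (use gU[OF q] t inU in auto)
  ultimately show thesis using that imD t(3) by blast
qed

lemma crossing_path_of_level:
  assumes tame: "tame D" and R: "R \<in> components (- D)" and c: "c \<in> R" and z: "z \<in> level D R k"
  shows "\<exists>g. crossing_path D c z k g"
  using z
proof (induction k arbitrary: z)
  case (0 z)
  have D: "closed D" using tame compact_imp_closed by (auto simp: tame_def)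
  obtain h where h: "path h" "path_image h \<subseteq> R" "pathstart h = c" "pathfinish h = z"
    using path_in_face[OF D R c, of z] 0 by auto
  have "path_image h \<inter> D = {}" using h(2) in_components_subset[OF R] by blast
  then show ?case using h by (auto simp: crossing_path_def intro!: exI[of _ h])
next
  case (Suc k z)
  have D: "closed D" using tame compact_imp_closed by (auto simp: tame_def)
  obtain F G p where F: "F \<in> components (- D)" "z \<in> F" and G: "G \<in> components (- D)" "G \<subseteq> level D R k"
    and p: "p \<notin> crossings D" "p \<in> closure F" "p \<in> closure G"
    using Suc.prems unfolding level.simps(2) by blast
  show ?case
  proof (cases "F = G")
    case True
    then obtain g where "crossing_path D c z k g" using Suc.IH F G by blast
    then have "crossing_path D c z (Suc k) g" by (auto simp: crossing_path_def)
    then show ?thesis by blast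
  next
    case False
    have "p \<in> D"
    proof (rule ccontr)
      assume "p \<notin> D"
      then have "p \<in> F" "p \<in> G" using face_closure[OF D] F G p by blast+
      then show False using components_nonoverlap[OF F(1) G(1)] False by blast
    qed
    then have reg: "regular D p" using p tame by (auto simp: tame_def)
    obtain w where w: "w \<in> G" using in_components_nonempty[OF G(1)] by blast
    obtain g where g: "crossing_path D c w k g" using Suc.IH G w by blast
    then have fin: "finite (path_image g \<inter> D)" by (simp add: crossing_path_def)
    obtain q \<sigma> where \<sigma>: "path \<sigma>" "pathstart \<sigma> \<in> G" "pathfinish \<sigma> \<in> F" "path_image \<sigma> \<inter> D = {q}"
      "q \<notin> path_image g \<inter> D" "crosses_in D (path_image \<sigma>) q"
      by (rule crossing_segment[OF reg F(1) G(1) False p(2,3) fin])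
    obtain h where h: "crossing_path D c (pathstart \<sigma>) k h" and hD: "path_image h \<inter> D = path_image g \<inter> D"
      using crossing_path_within_face[OF D g G(1) w \<sigma>(2)] by blast
    have hh: "path h" "pathfinish h = pathstart \<sigma>" "pathstart h = c" using h by (auto simp: crossing_path_def)
    have im: "path_image (h +++ \<sigma>) = path_image h \<union> path_image \<sigma>"
      using hh \<sigma> by (simp add: path_image_join)
    have imD: "path_image (h +++ \<sigma>) \<inter> D = insert q (path_image h \<inter> D)"
      unfolding im using \<sigma>(4) by blast
    have qh: "q \<notin> path_image h" using \<sigma>(4,5) hD by blast
    have "crosses_in D (path_image (h +++ \<sigma>)) r" if r: "r \<in> path_image (h +++ \<sigma>) \<inter> D" for r
    proof (cases "r = q")
      case True
      show ?thesis unfolding True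
      proof (rule crosses_in_local[OF \<sigma>(6)])
        show "open (- path_image h)" using closed_path_image[OF hh(1)] by blast
        show "q \<in> - path_image h" using qh by blast
      qed (auto simp: im)
    next
      case False
      then have rh: "r \<in> path_image h \<inter> D" using r imD by blast
      then have "crosses_in D (path_image h) r" using h by (auto simp: crossing_path_def)
      then show ?thesis
      proof (rule crosses_in_local)
        show "open (- path_image \<sigma>)" using closed_path_image[OF \<sigma>(1)] by blast
        show "r \<in> - path_image \<sigma>" using rh \<sigma>(4) False by blast
      qed (auto simp: im)
    qed
    moreover have "finite (path_image (h +++ \<sigma>) \<inter> D)" "card (path_image (h +++ \<sigma>) \<inter> D) \<le> Suc k"
      unfolding imD using h by (auto simp: crossing_path_def card_insert_if)
    ultimately have "crossing_path D c (pathfinish \<sigma>) (Suc k) (h +++ \<sigma>)"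
      using hh \<sigma> unfolding crossing_path_def by simp
    then show ?thesis using crossing_path_within_face[OF D _ F(1) \<sigma>(3) F(2)] by blast
  qed
qed

text \<open>
  Near \<open>p\<close> the second coordinate is an injective continuous function of the parameter of the arc. Its
  image is therefore open, and the arc covers a neighbourhood of \<open>p\<close> on the axis.
\<close>

lemma arc_crosses_transversally:
  assumes q: "arc q" and p: "p \<in> path_image q" "p \<noteq> pathstart q" "p \<noteq> pathfinish q"
    and cr: "crosses_in D (path_image q) p"
  shows "\<exists>U f. chart p U f \<and> looks_like D U f real_axis \<and> looks_like (path_image q) U f imag_axis"
proof -
  obtain U f where ch: "chart p U f" and L: "looks_like D U f real_axis"
    and I: "\<forall>z\<in>path_image q \<inter> U. f z \<in> imag_axis" using cr by (auto simp: crosses_in_def)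
  obtain g where g: "homeomorphism U (ball 0 1) f g" and U: "open U" "p \<in> U" "f p = 0" using ch by (auto simp: chart_def)
  have cont: "continuous_on {0..1} q" and inj: "inj_on q {0..1}" using q by (auto simp: arc_def path_def)
  obtain t0 where t0: "t0 \<in> {0..1}" "q t0 = p" using p(1) by (auto simp: path_image_def)
  then have "0 < t0" "t0 < 1" using p(2,3) by (auto simp: pathstart_def pathfinish_def order_less_le)
  define T where "T = {0<..<1} \<inter> q -` U"
  have T: "open T" unfolding T_def
    by (rule continuous_open_preimage) (use U cont in \<open>auto intro: continuous_on_subset\<close>)
  have t0T: "t0 \<in> T" using \<open>0 < t0\<close> \<open>t0 < 1\<close> t0 U by (simp add: T_def)
  define h where "h t = Im (f (q t))" for t
  have TU: "q t \<in> U" "t \<in> {0..1}" "f (q t) = Complex 0 (h t)" if "t \<in> T" for t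
  proof -
    show *: "q t \<in> U" "t \<in> {0..1}" using that by (auto simp: T_def)
    then have "q t \<in> path_image q \<inter> U" by (simp add: path_image_def)
    then have "f (q t) \<in> imag_axis" using I by blast
    then show "f (q t) = Complex 0 (h t)" by (simp add: imag_axis_def h_def complex_eq_iff)
  qed
  have "continuous_on T (\<lambda>t. f (q t))"
  proof (rule continuous_on_compose2[of U f])
    show "continuous_on U f" using g by (simp add: homeomorphism_def)
    show "continuous_on T q" using cont TU(2) by (meson continuous_on_subset subsetI)
  qed (use TU in auto)
  then have "continuous_on T h" unfolding h_def by (intro continuous_intros)
  moreover have "inj_on h T"
  proof (rule inj_onI)
    fix a b assume ab: "a \<in> T" "b \<in> T" "h a = h b"
    then have "f (q a) = f (q b)" using TU(3) by simp
    then have "q a = q b" using g TU(1) ab by (metis homeomorphism_apply1)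
    then show "a = b" using inj TU(2) ab by (meson inj_onD)
  qed
  ultimately have "open (h ` T)" using injective_into_1d_imp_open_map_UNIV[OF T] by blast
  moreover have "0 \<in> h ` T"
  proof (rule image_eqI[OF _ t0T])
    show "0 = h t0" using t0 U by (simp add: h_def)
  qed
  ultimately obtain d where d: "0 < d" "ball 0 d \<subseteq> h ` T" by (meson openE)
  define e where "e = min d 1"
  have e: "0 < e" "ball 0 e \<subseteq> h ` T" "ball (0::complex) e \<subseteq> ball 0 1" using d by (auto simp: e_def subset_iff)
  note c = chart_of_homeomorphism[OF g U e(1,3)]
  let ?V = "{z \<in> U. norm (f z) < e}"
  have "looks_like D ?V (\<lambda>z. f z / of_real e) real_axis"
    using L cone_axes(1) e unfolding looks_like_iff[OF c] looks_like_iff[OF ch] cone_def by blast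
  moreover have "z \<in> path_image q \<longleftrightarrow> f z \<in> imag_axis" if z: "z \<in> ?V" for z
  proof
    assume "f z \<in> imag_axis"
    then have fz: "f z = Complex 0 (Im (f z))" by (simp add: imag_axis_def complex_eq_iff)
    have "\<bar>Im (f z)\<bar> < e" using z abs_Im_le_cmod[of "f z"] by simp
    then have "Im (f z) \<in> h ` T" using e(2) by (auto simp: subset_iff)
    then obtain t where t: "t \<in> T" "h t = Im (f z)" by auto
    then have "f (q t) = f z" using TU(3) fz by simp
    then have "q t = z" using g TU(1)[OF t(1)] z by (metis (no_types, lifting) homeomorphism_apply1 mem_Collect_eq)
    then show "z \<in> path_image q" using TU(2)[OF t(1)] by (auto simp: path_image_def)
  qed (use I z in blast)
  then have "looks_like (path_image q) ?V (\<lambda>z. f z / of_real e) imag_axis"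
    using cone_axes(2) e(1) unfolding looks_like_iff[OF c] cone_def by blast
  ultimately show ?thesis using c by blast
qed

text \<open>
  A meridian is an arc; extracting one from the path keeps the local pictures and can only lower the
  number of crossing points.
\<close>

lemma meridian_of_crossing_path:
  assumes g: "crossing_path D c z k g" and z: "z \<in> outside D" "z \<noteq> c" and c: "c \<notin> D"
  shows "\<exists>m. meridian c D m \<and> card (path_image m \<inter> D) \<le> k"
proof -
  obtain q where q: "arc q" "path_image q \<subseteq> path_image g" "pathstart q = c" "pathfinish q = z"
    using g z path_contains_arc[of g c z] by (auto simp: crossing_path_def)
  have sub: "path_image q \<inter> D \<subseteq> path_image g \<inter> D" using q(2) by blast
  have fin: "finite (path_image g \<inter> D)" "card (path_image g \<inter> D) \<le> k" using g by (auto simp: crossing_path_def)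
  have cr: "crosses_in D (path_image q) p" if "p \<in> path_image q \<inter> D" for p
    using crosses_in_local[of D "path_image g" p UNIV "path_image q"] g q(2) sub that
    by (auto simp: crossing_path_def)
  then have "regular D p" if "p \<in> path_image q \<inter> D" for p
    using that unfolding crosses_in_def regular_def by blast
  then have "path_image q \<inter> crossings D = {}"
    using regular_not_crossing crossings_subset by blast
  moreover have "\<exists>U f. chart p U f \<and> looks_like D U f real_axis \<and> looks_like (path_image q) U f imag_axis"
    if p: "p \<in> path_image q \<inter> D" for p
  proof (rule arc_crosses_transversally[OF q(1) _ _ _ cr[OF p]])
    have "p \<noteq> pathstart q \<and> p \<noteq> pathfinish q"
    proof -
      have "p \<in> D" "z \<notin> D" using p z(1) outside_no_overlap[of D] by blast+
      then show ?thesis using q(3,4) c by blast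
    qed
    then show "p \<noteq> pathstart q" "p \<noteq> pathfinish q" by simp_all
  qed (use p in blast)
  ultimately have "meridian c D q"
    using q z fin sub finite_subset unfolding meridian_def by blast
  moreover have "card (path_image q \<inter> D) \<le> k" using card_mono[OF fin(1) sub] fin(2) by simp
  ultimately show ?thesis by blast
qed

section \<open>The wrapping number\<close>

lemma knot_diagram_tame:
  assumes "knot_diagram c \<gamma> over" shows "tame (shadow \<gamma>)"
proof -
  have "compact (shadow \<gamma>)"
    using assms compact_continuous_image[of "sphere 0 1" \<gamma>] by (simp add: knot_diagram_def shadow_def)
  moreover have "p \<in> crossings (shadow \<gamma>) \<or> regular (shadow \<gamma>) p" if p: "p \<in> shadow \<gamma>" for p
  proof -
    consider "regular_point \<gamma> p" | "transverse_double_point \<gamma> p"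
      using assms p unfolding knot_diagram_def by blast
    then show ?thesis
    proof cases
      case 1 then show ?thesis unfolding regular_point_def regular_def by blast
    next
      case 2 then show ?thesis unfolding transverse_double_point_def crossings_def by blast
    qed
  qed
  ultimately show ?thesis using assms by (simp add: tame_def knot_diagram_def)
qed

theorem corollary1:
  fixes c :: complex and \<gamma> over :: "complex \<Rightarrow> complex" and Dstar :: colored_diagram
  assumes "knot_diagram c \<gamma> over"
    and "method1 c (shadow \<gamma>) Dstar"
  shows "wrapping_number c (shadow \<gamma>) = ec Dstar"
proof -
  let ?D = "shadow \<gamma>" and ?R = "connected_component_set (- shadow \<gamma>) c" and ?n = "length (snd Dstar)"
  have tame: "tame ?D" using knot_diagram_tame assms(1) .
  then have D: "compact ?D" by (simp add: tame_def)
  have c: "c \<notin> ?D" using assms(1) by (simp add: knot_diagram_def)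
  then have R: "?R \<in> components (- ?D)" "c \<in> ?R" by (auto intro: componentsI)
  have run: "color_from c ?D ?R (fst Dstar) (snd Dstar)" using assms(2) by (simp add: method1_def)
  obtain \<phi> B where \<phi>: "face_potential ?D \<phi>" "\<forall>z\<in>?R. \<phi> z = 0" "\<forall>z. B < norm z \<longrightarrow> \<phi> z = int ?n"
    using procedure_potential[OF run tame R(1)] by blast
  have lower: "?n \<le> card (path_image m \<inter> ?D)" if "meridian c ?D m" for m
    using meridian_ge_potential[OF D \<phi>(1) _ c _ that, of B ?n] \<phi>(2,3) R(2) by blast
  obtain B1 where B1: "\<forall>z. B1 < norm z \<longrightarrow> z \<in> level ?D ?R ?n"
    using procedure_level[OF run tame R(1)] by blast
  obtain B2 where B2: "\<forall>z. B2 < norm z \<longrightarrow> z \<in> outside ?D"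
    using far_points_outside compact_imp_bounded[OF D] by blast
  define z where "z = complex_of_real (1 + \<bar>B1\<bar> + \<bar>B2\<bar> + norm c)"
  have "norm z = 1 + \<bar>B1\<bar> + \<bar>B2\<bar> + norm c" unfolding z_def norm_of_real by simp
  then have z: "B1 < norm z" "B2 < norm z" "norm c < norm z" using norm_ge_zero[of c] by linarith+
  obtain g where "crossing_path ?D c z ?n g"
    using crossing_path_of_level[OF tame R] B1 z(1) by blast
  then obtain m where m: "meridian c ?D m" "card (path_image m \<inter> ?D) \<le> ?n"
    using meridian_of_crossing_path[of ?D c z ?n g] B2 z c by blast
  show ?thesis
    unfolding wrapping_number_def ec_def
  proof (rule Least_equality)
    show "\<exists>m. meridian c ?D m \<and> card (path_image m \<inter> ?D) = ?n" using m lower[OF m(1)] by (metis le_antisym)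
  qed (use lower in blast)
qed

end
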